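(* Let $\Omega=\Omega_1\times\cdots\times\Omega_d\subseteq\mathbb{R}^d$ with $\mu(\Omega)<\infty$, let $\vec p=(p_1,\dots,p_d)$ with $0<p_i\le\infty$ for all $i$ and $p_{\min}:=\min\{p_1,\dots,p_d\}<\infty$. Let $\varepsilon>0$ be sufficiently small, let $\varkappa$ be a positive monotonically decreasing function on $(0,\varepsilon]$, and let $0<v\le\infty$. Then $$\left(\int_0^\varepsilon\left[\varkappa(t)\,t^{1/p_{\min}}f^*(t)\right]^v\frac{dt}{t}\right)^{1/v}\le c\,\|f\|_{\vec p}$$ holds for some $c>0$ and all $f\in L_{\vec p}(\Omega)$ if, and only if, $\varkappa$ is bounded on $(0,\varepsilon]$ and $p_{\min}\le v\le\infty$, where for $v=\infty$ the inequality is to be read as $$\sup_{0<t<\varepsilon}\varkappa(t)\,t^{1/p_{\min}}f^*(t)\le c\,\|f\|_{\vec p}.\qquad( * )$$ In particular, if $\varkappa$ is an arbitrary non-negative function on $(0,\varepsilon]$, then $( * )$ holds (for some $c>0$ and all $f\in L_{\vec p}(\Omega)$) if, and only if, $\varkappa$ is bounded.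
   Context: Setting: $\Omega_1,\dots,\Omega_d\subseteq\mathbb{R}$ are Lebesgue measurable sets of positive measure, $\Omega=\prod_i\Omega_i$, and $\mu$ is Lebesgue measure on $\Omega$. "Sufficiently small" means $0<\varepsilon\le\varepsilon_0$ for some $\varepsilon_0>0$ depending only on $\Omega$ and $\vec p$. Mixed Lebesgue space: $L_{\vec p}(\Omega)$ consists of the measurable $f:\Omega\to\mathbb{R}$ with finite quasi-norm $$\|f\|_{\vec p}=\left(\int_{\Omega_d}\cdots\left(\int_{\Omega_1}|f(x_1,\dots,x_d)|^{p_1}\,dx_1\right)^{p_2/p_1}\cdots\,dx_d\right)^{1/p_d},$$ i.e. one takes the $L_{p_1}$ quasi-norm in $x_1$, then the $L_{p_2}$ quasi-norm in $x_2$, etc., with the essential supremum in $x_j$ if $p_j=\infty$. Rearrangement: $f^*(t)=\inf\{s>0:\mu(\{|f|>s\})\le t\}$, $t\ge0$ (with $\inf\emptyset=\infty$). *)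

theory Defs
  imports "HOL-Analysis.Analysis" "HOL-Probability.Essential_Supremum"
begin

text \<open>Points of \<open>\<real>\<^sup>d\<close> are the extensional functions \<open>{1..d} \<rightarrow>\<^sub>E UNIV\<close>, so that the coordinates can be
  integrated out one after another by recursion. The completion makes the sets of the measure
  below exactly the Lebesgue measurable subsets of \<open>\<Omega>\<close> (a product of the one-dimensional
  \<open>lebesgue\<close> measures would be too small).\<close>

definition lebesgue_Pi :: "nat \<Rightarrow> (nat \<Rightarrow> real set) \<Rightarrow> (nat \<Rightarrow> real) measure" where
  "lebesgue_Pi d \<Omega> =
     restrict_space (completion (Pi\<^sub>M {1..d} (\<lambda>_. lborel))) (Pi\<^sub>E {1..d} \<Omega>)"

text \<open>Only used for exponents \<open>a > 0\<close>, where \<open>0 powr a = 0\<close> is the right value.\<close>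

definition ennpowr :: "ennreal \<Rightarrow> real \<Rightarrow> ennreal" where
  "ennpowr x a = (if x = \<infinity> then \<infinity> else ennreal (enn2real x powr a))"

definition Lq_norm :: "ennreal \<Rightarrow> 'a measure \<Rightarrow> ('a \<Rightarrow> ennreal) \<Rightarrow> ennreal" where
  "Lq_norm q M g =
     (if q = \<infinity> then esssup M g
      else ennpowr (\<integral>\<^sup>+x. ennpowr (g x) (enn2real q) \<partial>M) (1 / enn2real q))"

text \<open>\<open>mixed_norm_upto \<Omega> p k F x\<close> takes the quasi-norms in the coordinates \<open>1, \<dots>, k\<close>, in this order
  (coordinate 1 innermost), the remaining coordinates being those of \<open>x\<close>. For Lebesgue measurable
  \<open>F\<close> an inner function may fail to be measurable on a null set of outer variables; the values
  there do not affect the result.\<close>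

primrec mixed_norm_upto ::
  "(nat \<Rightarrow> real set) \<Rightarrow> (nat \<Rightarrow> ennreal) \<Rightarrow> nat \<Rightarrow> ((nat \<Rightarrow> real) \<Rightarrow> ennreal) \<Rightarrow> (nat \<Rightarrow> real) \<Rightarrow> ennreal"
where
  "mixed_norm_upto \<Omega> p 0 F = F"
| "mixed_norm_upto \<Omega> p (Suc k) F =
     (\<lambda>x. Lq_norm (p (Suc k)) (lebesgue_on (\<Omega> (Suc k)))
            (\<lambda>t. mixed_norm_upto \<Omega> p k F (x(Suc k := t))))"

definition mixed_norm ::
  "nat \<Rightarrow> (nat \<Rightarrow> real set) \<Rightarrow> (nat \<Rightarrow> ennreal) \<Rightarrow> ((nat \<Rightarrow> real) \<Rightarrow> real) \<Rightarrow> ennreal" where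
  "mixed_norm d \<Omega> p f = mixed_norm_upto \<Omega> p d (\<lambda>x. ennreal \<bar>f x\<bar>) (\<lambda>_. undefined)"

definition mixed_Lebesgue ::
  "nat \<Rightarrow> (nat \<Rightarrow> real set) \<Rightarrow> (nat \<Rightarrow> ennreal) \<Rightarrow> ((nat \<Rightarrow> real) \<Rightarrow> real) set" where
  "mixed_Lebesgue d \<Omega> p =
     {f. f \<in> borel_measurable (lebesgue_Pi d \<Omega>) \<and> mixed_norm d \<Omega> p f < \<infinity>}"

definition rearrangement :: "'a measure \<Rightarrow> ('a \<Rightarrow> real) \<Rightarrow> real \<Rightarrow> ennreal" where
  "rearrangement M f t =
     Inf (ennreal ` {s. 0 < s \<and> emeasure M {x \<in> space M. s < \<bar>f x\<bar>} \<le> ennreal t})"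

definition weighted_rearr_norm ::
  "real \<Rightarrow> (real \<Rightarrow> real) \<Rightarrow> real \<Rightarrow> ennreal \<Rightarrow> (real \<Rightarrow> ennreal) \<Rightarrow> ennreal" where
  "weighted_rearr_norm \<epsilon> \<kappa> q v g =
     (if v = \<infinity> then (SUP t\<in>{0<..<\<epsilon>}. ennreal (\<kappa> t * t powr (1 / q)) * g t)
      else ennpowr (\<integral>\<^sup>+t\<in>{0<..<\<epsilon>}. (ennpowr (ennreal (\<kappa> t * t powr (1 / q)) * g t) (enn2real v)
             * ennreal (1 / t)) \<partial>lborel) (1 / enn2real v))"

end

theory Submission
  imports Defs "HOL-Probability.Distribution_Functions"
begin

text \<open>Let \<open>q = p_min\<close>. Sufficiency: \<open>\<Omega>\<close> has finite measure, so in each coordinate the \<open>L_q\<close> quasi-norm is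
  bounded by a multiple of the \<open>L_{p_i}\<close> quasi-norm; with Tonelli this embeds the mixed space into
  \<open>L_q(\<Omega>)\<close>. Writing \<open>Q\<close> for the integral of \<open>|f|\<^sup>q\<close>, the layer cake formula shows that
  \<open>f*\<^sup>q\<close> has integral at most \<open>Q\<close>, hence \<open>t f*(t)\<^sup>q \<le> Q\<close> by monotonicity, and the case of general \<open>v \<ge> q\<close>
  follows from \<open>[t\<^bsup>1/q\<^esup> f*]\<^sup>v / t = (t f*\<^sup>q)\<^bsup>v/q - 1\<^esup> f*\<^sup>q\<close>.

  Necessity: choose \<open>j\<close> with \<open>p_j = q\<close> and test with
  \<open>f(x) = (\<Sum>k\<le>n. 2\<^sup>k 1[x_j \<le> y_k])\<^bsup>1/q\<^esup>\<close>, where \<open>y_k\<close> is such that the \<open>k\<close>-th set has measure \<open>b / 2\<^sup>k\<close>.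
  The norm of \<open>f\<close> is a multiple of \<open>((n + 1) b)\<^bsup>1/q\<^esup>\<close>, while each dyadic interval contributes equally to the
  left-hand side, which is at least a multiple of \<open>\<kappa>(b) b\<^bsup>1/q\<^esup> (n + 1)\<^bsup>1/v\<^esup>\<close>. Taking \<open>n = 0\<close> bounds
  \<open>\<kappa>\<close>, and \<open>n \<rightarrow> \<infinity>\<close> gives \<open>v \<ge> q\<close>.\<close>

section \<open>Powers of extended reals and a one-dimensional embedding\<close>

lemma ennpowr_ennreal: "0 \<le> x \<Longrightarrow> ennpowr (ennreal x) a = ennreal (x powr a)"
  by (simp add: ennpowr_def)

lemma ennpowr_top [simp]: "ennpowr \<infinity> a = \<infinity>" "ennpowr top a = top"
  by (simp_all add: ennpowr_def)

lemma ennpowr_0 [simp]: "ennpowr 0 a = 0"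
  by (simp add: ennpowr_def)

lemma ennpowr_1 [simp]: "ennpowr x 1 = x"
  by (cases x) (auto simp: ennpowr_def)

lemma ennpowr_eq_0_iff [simp]: "ennpowr x a = 0 \<longleftrightarrow> x = 0"
  by (cases x) (auto simp: ennpowr_def)

lemma ennpowr_mono: "x \<le> y \<Longrightarrow> 0 \<le> a \<Longrightarrow> ennpowr x a \<le> ennpowr y a"
  by (cases x; cases y) (auto simp: ennpowr_ennreal top_unique intro!: ennreal_leI powr_mono2)

text \<open>Consistent also with \<open>0 * top = 0\<close>, since every power fixes
  \<open>0\<close> and \<open>top\<close>.\<close>

lemma ennpowr_mult: "ennpowr (x * y) a = ennpowr x a * ennpowr y a"
proof (cases "x = top \<or> y = top")
  case True
  then show ?thesis
    by (auto simp: ennreal_mult_top ennreal_top_mult)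
next
  case False
  then obtain r s where "x = ennreal r" "y = ennreal s" "0 \<le> r" "0 \<le> s"
    by (metis ennreal_cases)
  then show ?thesis
    by (simp add: ennpowr_ennreal powr_mult flip: ennreal_mult)
qed

lemma ennpowr_ennpowr: "ennpowr (ennpowr x a) b = ennpowr x (a * b)"
  by (cases x) (auto simp: ennpowr_ennreal powr_powr)

text \<open>The power \<open>1 / a\<close> undoes the power \<open>a\<close>, so monotonicity in
  both directions gives strictness.\<close>

lemma ennpowr_less_iff: "0 < a \<Longrightarrow> ennpowr x a < ennpowr y a \<longleftrightarrow> x < y"
  using ennpowr_mono[of x y a] ennpowr_mono[of "ennpowr y a" "ennpowr x a" "1/a"]
    ennpowr_mono[of y x a]
  by (cases "x = y") (auto simp: ennpowr_ennpowr not_le[symmetric])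

lemma measurable_ennpowr [measurable]:
  assumes [measurable]: "g \<in> borel_measurable M"
  shows "(\<lambda>x. ennpowr (g x) a) \<in> borel_measurable M"
  unfolding ennpowr_def by measurable

text \<open>Integrated with \<open>l = (\<integral> h\<^sup>r)\<^bsup>1/r\<^esup>\<close>, this replaces Jensen's inequality up to a constant.\<close>

lemma le_add_powr:
  fixes h l r :: real
  assumes "0 \<le> h" "0 < l" "1 \<le> r"
  shows "h \<le> l + l powr (1 - r) * h powr r"
proof (cases "h \<le> l")
  case True
  then show ?thesis using assms by (simp add: add_increasing2)
next
  case False
  have "h = h powr (1 - r) * h powr r"
    using False assms by (simp flip: powr_add)
  also have "\<dots> \<le> l powr (1 - r) * h powr r"
    using False assms by (intro mult_right_mono powr_mono2') auto
  finally show ?thesis using assms by linarith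
qed



text \<open>Hoelder's inequality on a finite measure space, with a cruder constant. The two terms of
  \<open>le_add_powr\<close> integrate to \<open>l\<close> times the total mass and to
  \<open>l\<close>. The values \<open>0\<close> and \<open>top\<close> of the integral are treated
  separately because \<open>l\<close> has to be positive and finite.\<close>

lemma nn_integral_le_ennpowr:
  fixes r :: real
  assumes "finite_measure M" and [measurable]: "h \<in> borel_measurable M" and r: "1 \<le> r"
  shows "(\<integral>\<^sup>+x. h x \<partial>M)
    \<le> ennreal (measure M (space M) + 1) * ennpowr (\<integral>\<^sup>+x. ennpowr (h x) r \<partial>M) (1 / r)"
proof -
  interpret finite_measure M by fact
  define I where "I = (\<integral>\<^sup>+x. ennpowr (h x) r \<partial>M)"
  consider "I = top" | "I = 0" | i where "I = ennreal i" "0 < i"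
    by (cases I) (auto simp: le_less)
  then show ?thesis
  proof cases
    case 1
    have "ennreal (measure M (space M) + 1) \<noteq> 0"
      using measure_nonneg[of M "space M"] by (simp add: ennreal_eq_0_iff not_le)
    then show ?thesis using 1 by (simp add: I_def[symmetric] ennreal_mult_top)
  next
    case 2
    then have "AE x in M. h x = 0"
      unfolding I_def by (subst (asm) nn_integral_0_iff_AE) auto
    then have "(\<integral>\<^sup>+x. h x \<partial>M) = 0"
      by (subst nn_integral_0_iff_AE) auto
    then show ?thesis by simp
  next
    case 3
    define l where "l = i powr (1 / r)"
    have l: "0 < l" using 3 by (simp add: l_def)
    have "(\<integral>\<^sup>+x. h x \<partial>M) \<le> (\<integral>\<^sup>+x. ennreal l + ennreal (l powr (1 - r)) * ennpowr (h x) r \<partial>M)"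
    proof (rule nn_integral_mono)
      fix x
      show "h x \<le> ennreal l + ennreal (l powr (1 - r)) * ennpowr (h x) r"
      proof (cases "h x")
        case (real y)
        then show ?thesis using le_add_powr[of y l r] l r
          by (simp add: ennpowr_ennreal flip: ennreal_mult ennreal_plus)
      next
        case top
        then show ?thesis using l by (simp add: ennreal_mult_top)
      qed
    qed
    also have "\<dots> = ennreal l * emeasure M (space M) + ennreal (l powr (1 - r)) * I"
      by (simp add: nn_integral_add nn_integral_cmult I_def)
    also have "\<dots> = ennreal (l * measure M (space M) + l powr (1 - r) * i)"
      using l 3 by (simp add: emeasure_eq_measure flip: ennreal_mult ennreal_plus)
    also have "l powr (1 - r) * i = l"
    proof -
      have "i = l powr r" using 3 r by (simp add: l_def powr_powr)
      then show ?thesis using l by (simp flip: powr_add)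
    qed
    finally show ?thesis
      using 3 l by (simp add: I_def[symmetric] ennpowr_ennreal l_def algebra_simps flip: ennreal_mult)
  qed
qed

text \<open>No measurability of \<open>g\<close> is assumed because the inner functions of a mixed norm may lack it.
  In the proof the constant is moved to the side of \<open>h\<close>, since it could not be pulled out
  of the integral of \<open>g\<close>.\<close>

lemma nn_integral_le_Lq_norm:
  fixes q c :: real and g h :: "'a \<Rightarrow> ennreal"
  assumes "finite_measure M" and [measurable]: "h \<in> borel_measurable M"
    and q: "0 < q" "ennreal q \<le> p" and c: "0 < c"
    and le: "AE x in M. h x \<le> ennreal c * ennpowr (g x) q"
  shows "(\<integral>\<^sup>+x. h x \<partial>M) \<le> ennreal (c * (measure M (space M) + 1)) * ennpowr (Lq_norm p M g) q"
proof -
  interpret finite_measure M by fact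
  define h' where "h' x = ennreal (1 / c) * h x" for x
  have [measurable]: "h' \<in> borel_measurable M" unfolding h'_def by measurable
  have h: "h x = ennreal c * h' x" for x
    using c by (simp add: h'_def mult.assoc[symmetric] flip: ennreal_mult)
  have le': "AE x in M. h' x \<le> ennpowr (g x) q"
    using le
  proof eventually_elim
    case (elim x)
    then have "h' x \<le> ennreal (1 / c) * (ennreal c * ennpowr (g x) q)"
      unfolding h'_def by (rule mult_left_mono) simp
    then show ?case using c by (simp add: mult.assoc[symmetric] flip: ennreal_mult)
  qed
  have "(\<integral>\<^sup>+x. h' x \<partial>M) \<le> ennreal (measure M (space M) + 1) * ennpowr (Lq_norm p M g) q"
  proof (cases p)
    case (real s)
    with q have s: "0 < s" "q \<le> s" by auto
    have "(\<integral>\<^sup>+x. h' x \<partial>M)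
        \<le> ennreal (measure M (space M) + 1) * ennpowr (\<integral>\<^sup>+x. ennpowr (h' x) (s / q) \<partial>M) (1 / (s / q))"
      using s q assms(1) by (intro nn_integral_le_ennpowr) auto
    also have "(\<integral>\<^sup>+x. ennpowr (h' x) (s / q) \<partial>M) \<le> (\<integral>\<^sup>+x. ennpowr (g x) s \<partial>M)"
    \<comment> \<open>\<open>nn_integral\<close> is a supremum over simple functions below the
      integrand, hence monotone for arbitrary \<open>g\<close>.\<close>
    proof (rule nn_integral_mono_AE)
      show "AE x in M. ennpowr (h' x) (s / q) \<le> ennpowr (g x) s"
        using le'
      proof eventually_elim
        case (elim x)
        then have "ennpowr (h' x) (s / q) \<le> ennpowr (ennpowr (g x) q) (s / q)"
          using s q by (intro ennpowr_mono) auto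
        then show ?case using q by (simp add: ennpowr_ennpowr)
      qed
    qed
    also have "ennpowr (\<integral>\<^sup>+x. ennpowr (g x) s \<partial>M) (1 / (s / q)) = ennpowr (Lq_norm p M g) q"
      using real s by (simp add: Lq_norm_def ennpowr_ennpowr)
    finally show ?thesis using s q by (auto simp: mult_left_mono ennpowr_mono)
  next
    case top
    have "(\<integral>\<^sup>+x. h' x \<partial>M) \<le> (\<integral>\<^sup>+x. ennpowr (esssup M g) q \<partial>M)"
    \<comment> \<open>For non-measurable \<open>g\<close> the value of \<open>esssup\<close> is
      \<open>top\<close>, so \<open>esssup_AE\<close> covers that case too.\<close>
    proof (rule nn_integral_mono_AE)
      show "AE x in M. h' x \<le> ennpowr (esssup M g) q"
        using le' esssup_AE[of g M]
      proof eventually_elim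
        case (elim x)
        then show ?case using ennpowr_mono[of "g x" "esssup M g" q] q by simp
      qed
    qed
    also have "\<dots> = ennreal (measure M (space M)) * ennpowr (esssup M g) q"
      by (simp add: emeasure_eq_measure mult.commute)
    also have "\<dots> \<le> ennreal (measure M (space M) + 1) * ennpowr (esssup M g) q"
      by (intro mult_right_mono ennreal_leI) auto
    finally show ?thesis using top by (simp add: Lq_norm_def)
  qed
  then have "ennreal c * (\<integral>\<^sup>+x. h' x \<partial>M)
      \<le> ennreal c * (ennreal (measure M (space M) + 1) * ennpowr (Lq_norm p M g) q)"
    by (rule mult_left_mono) simp
  then show ?thesis
    using c by (simp add: h nn_integral_cmult mult.assoc ennreal_mult)
qed

section \<open>The box as a product of Borel measures\<close>

declare One_nat_def [simp del]

text \<open>Each \<open>E i\<close> is a Borel set \<open>B i\<close> up to a subset of a Borel null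
  set \<open>Z i\<close>. The two boxes then differ inside \<open>W\<close>, a finite union of null
  cylinders, and the product formula carries over from the \<open>B i\<close>.\<close>

lemma
  fixes E :: "'i \<Rightarrow> real set"
  assumes I: "finite I" and E: "\<And>i. i \<in> I \<Longrightarrow> E i \<in> sets lebesgue"
  shows sets_completion_PiE: "Pi\<^sub>E I E \<in> sets (completion (Pi\<^sub>M I (\<lambda>_. lborel)))" (is ?A)
    and emeasure_completion_PiE:
      "emeasure (completion (Pi\<^sub>M I (\<lambda>_. lborel))) (Pi\<^sub>E I E) = (\<Prod>i\<in>I. emeasure lebesgue (E i))" (is ?B)
proof -
  interpret product_sigma_finite "\<lambda>_::'i. lborel :: real measure" ..
  let ?P = "Pi\<^sub>M I (\<lambda>_. lborel :: real measure)"
  define B where "B i = main_part lborel (E i)" for i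
  have B: "B i \<in> sets lborel" if "i \<in> I" for i
    using E[OF that] unfolding B_def by (rule main_part_sets)
  have "\<forall>i\<in>I. \<exists>Z. Z \<in> null_sets lborel \<and> null_part lborel (E i) \<subseteq> Z"
    using E by (auto intro: null_part)
  then obtain Z where Z: "\<And>i. i \<in> I \<Longrightarrow> Z i \<in> null_sets lborel"
      "\<And>i. i \<in> I \<Longrightarrow> null_part lborel (E i) \<subseteq> Z i"
    by metis
  have un: "E i = B i \<union> null_part lborel (E i)" if "i \<in> I" for i
    using E[OF that] by (simp add: B_def)
  define W where "W = (\<Union>i\<in>I. Pi\<^sub>E I (\<lambda>j. if j = i then Z i else UNIV))"
  have W: "W \<in> null_sets ?P"
    unfolding W_def
  proof (rule null_sets.finite_UN[OF I])
    fix i assume i: "i \<in> I"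
    have "emeasure ?P (Pi\<^sub>E I (\<lambda>j. if j = i then Z i else UNIV))
        = (\<Prod>j\<in>I. emeasure lborel (if j = i then Z i else UNIV))"
      using I i null_setsD2[OF Z(1)] by (intro emeasure_PiM) auto
    \<comment> \<open>The factors of the other coordinates are \<open>top\<close>, but
      \<open>0 * top = 0\<close> in \<open>ennreal\<close>.\<close>
    also have "\<dots> = 0"
      using I i Z(1)[OF i] by (auto intro!: prod_zero bexI[of _ i])
    finally show "Pi\<^sub>E I (\<lambda>j. if j = i then Z i else UNIV) \<in> null_sets ?P"
      using I i Z(1)[OF i] by (intro null_setsI sets_PiM_I_finite) auto
  qed
  have sub: "Pi\<^sub>E I B \<subseteq> Pi\<^sub>E I E"
    using un by (intro PiE_mono) auto
  have diff: "Pi\<^sub>E I E - Pi\<^sub>E I B \<subseteq> W"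
  proof
    fix x assume x: "x \<in> Pi\<^sub>E I E - Pi\<^sub>E I B"
    then obtain i where i: "i \<in> I" "x i \<notin> B i" by (auto simp: PiE_iff)
    with x have "x i \<in> Z i" using un[OF i(1)] Z(2)[OF i(1)] by (auto simp: PiE_iff)
    then show "x \<in> W" using i x by (auto simp: W_def PiE_iff)
  qed
  have PB: "Pi\<^sub>E I B \<in> sets ?P" using I B by (intro sets_PiM_I_finite) auto
  have eq: "Pi\<^sub>E I E = Pi\<^sub>E I B \<union> (Pi\<^sub>E I E - Pi\<^sub>E I B)" using sub by auto
  have null: "Pi\<^sub>E I E - Pi\<^sub>E I B \<in> null_sets (completion ?P)"
    using W diff by (meson null_sets_completion_iff2)
  show ?A by (subst eq, rule sets.Un) (use PB null in auto)
  have "emeasure (completion ?P) (Pi\<^sub>E I E) = emeasure (completion ?P) (Pi\<^sub>E I B)"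
    by (subst eq, rule emeasure_Un_null_set) (use PB null in \<open>auto simp del: emeasure_completion\<close>)
  also have "\<dots> = (\<Prod>i\<in>I. emeasure lborel (B i))"
    using I B PB by (simp add: emeasure_PiM)
  also have "\<dots> = (\<Prod>i\<in>I. emeasure lebesgue (E i))"
    using E by (intro prod.cong) (auto simp: B_def)
  finally show ?B .
qed

lemma sets_PiE_lebesgue_Pi:
  fixes \<Omega> :: "nat \<Rightarrow> real set"
  assumes "\<And>i. i \<in> {1..d} \<Longrightarrow> \<Omega> i \<in> sets lebesgue"
  shows "Pi\<^sub>E {1..d} \<Omega> \<in> sets (completion (Pi\<^sub>M {1..d} (\<lambda>_. lborel)))"
  using assms by (intro sets_completion_PiE) auto

lemma space_lebesgue_Pi: "space (lebesgue_Pi d \<Omega>) = Pi\<^sub>E {1..d} \<Omega>"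
  by (auto simp: lebesgue_Pi_def space_restrict_space space_PiM PiE_iff)

lemma emeasure_lebesgue_Pi_PiE:
  assumes "\<And>i. i \<in> {1..d} \<Longrightarrow> \<Omega> i \<in> sets lebesgue"
    and "\<And>i. i \<in> {1..d} \<Longrightarrow> A i \<in> sets lebesgue"
    and "\<And>i. i \<in> {1..d} \<Longrightarrow> A i \<subseteq> \<Omega> i"
  shows "emeasure (lebesgue_Pi d \<Omega>) (Pi\<^sub>E {1..d} A) = (\<Prod>i\<in>{1..d}. emeasure lebesgue (A i))"
proof -
  have "emeasure (lebesgue_Pi d \<Omega>) (Pi\<^sub>E {1..d} A)
      = emeasure (completion (Pi\<^sub>M {1..d} (\<lambda>_. lborel))) (Pi\<^sub>E {1..d} A)"
    unfolding lebesgue_Pi_def using assms sets_PiE_lebesgue_Pi[of d \<Omega>]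
    by (intro emeasure_restrict_space PiE_mono) (auto simp: space_PiM PiE_def)
  then show ?thesis using assms by (simp only: emeasure_completion_PiE finite_atLeastAtMost)
qed

lemma measurable_lebesgue_Pi:
  "f \<in> measurable (Pi\<^sub>M {1..d} (\<lambda>_. lborel)) N \<Longrightarrow> f \<in> measurable (lebesgue_Pi d \<Omega>) N"
  unfolding lebesgue_Pi_def by (intro measurable_restrict_space1 measurable_completion)

text \<open>Pushing the measures forward to the Borel sets makes Tonelli's theorem for \<open>Pi\<^sub>M\<close> applicable although the
  sets \<open>\<Omega> i\<close> need not be Borel. The values outside \<open>{1..d}\<close> only ensure \<open>\<sigma>\<close>-finiteness.\<close>

definition coord_measure :: "nat \<Rightarrow> (nat \<Rightarrow> real set) \<Rightarrow> nat \<Rightarrow> real measure" where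
  "coord_measure d \<Omega> i =
     (if i \<in> {1..d} then distr (lebesgue_on (\<Omega> i)) borel (\<lambda>x. x) else lborel)"

section \<open>The box measure pushed forward to the Borel sets\<close>

locale lebesgue_box =
  fixes d :: nat and \<Omega> :: "nat \<Rightarrow> real set"
  assumes \<Omega>: "i \<in> {1..d} \<Longrightarrow> \<Omega> i \<in> sets lebesgue"
    and finite_\<Omega>: "i \<in> {1..d} \<Longrightarrow> emeasure lebesgue (\<Omega> i) < \<infinity>"
begin

abbreviation "N \<equiv> coord_measure d \<Omega>"
abbreviation "\<mu> \<equiv> lebesgue_Pi d \<Omega>"

lemma sets_N [measurable_cong, simp]: "sets (N i) = sets borel"
  by (simp add: coord_measure_def)

lemma space_N [simp]: "space (N i) = UNIV"
  using sets_eq_imp_space_eq[OF sets_N[of i]] by simp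

lemma finite_measure_lebesgue_on: "i \<in> {1..d} \<Longrightarrow> finite_measure (lebesgue_on (\<Omega> i))"
  using \<Omega>[of i] finite_\<Omega>[of i]
  by (intro finite_measureI) (simp add: emeasure_restrict_space space_restrict_space del: emeasure_completion)

lemma measurable_id_lebesgue_on: "(\<lambda>x. x) \<in> measurable (lebesgue_on S) (borel :: real measure)"
  by (intro measurable_restrict_space1) (auto simp: measurable_def)

lemma measurable_lebesgue_on_borel: "f \<in> borel_measurable borel \<Longrightarrow> f \<in> borel_measurable (lebesgue_on (S :: real set))"
  by (rule measurable_compose[OF measurable_id_lebesgue_on])

lemma finite_measure_N: "i \<in> {1..d} \<Longrightarrow> finite_measure (N i)"
  using finite_measure_lebesgue_on[of i]
  by (auto simp: coord_measure_def intro!: finite_measure.finite_measure_distr measurable_id_lebesgue_on)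

sublocale product_sigma_finite N
proof (rule product_sigma_finite.intro)
  fix i
  show "sigma_finite_measure (N i)"
  proof (cases "i \<in> {1..d}")
    case True
    then interpret finite_measure "N i" by (rule finite_measure_N)
    show ?thesis ..
  next
    case False
    then show ?thesis by (auto simp: coord_measure_def intro: sigma_finite_lborel)
  qed
qed

lemma nn_integral_N:
  assumes "i \<in> {1..d}" "f \<in> borel_measurable borel"
  shows "(\<integral>\<^sup>+x. f x \<partial>N i) = (\<integral>\<^sup>+x. f x \<partial>lebesgue_on (\<Omega> i))"
  using assms by (simp add: coord_measure_def nn_integral_distr[OF measurable_id_lebesgue_on])

lemma emeasure_N:
  assumes "i \<in> {1..d}" "A \<in> sets borel"
  shows "emeasure (N i) A = emeasure lebesgue (A \<inter> \<Omega> i)"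
  using assms \<Omega>[of i]
  by (auto simp: coord_measure_def emeasure_distr[OF measurable_id_lebesgue_on] emeasure_restrict_space space_restrict_space simp del: emeasure_completion)

lemma AE_N:
  assumes "i \<in> {1..d}" "AE x in N i. Q x"
  shows "AE x in lebesgue_on (\<Omega> i). Q x"
proof -
  have *: "N i = distr (lebesgue_on (\<Omega> i)) borel (\<lambda>x. x)"
    using assms(1) by (simp add: coord_measure_def)
  show ?thesis
    by (rule AE_distrD[OF measurable_id_lebesgue_on assms(2)[unfolded *]])
qed

lemma sets_PiM_N: "sets (Pi\<^sub>M I N) = sets (Pi\<^sub>M I (\<lambda>_. lborel))"
  by (rule sets_PiM_cong) auto

lemma measurable_id_\<mu>: "(\<lambda>x. x) \<in> measurable \<mu> (Pi\<^sub>M {1..d} N)"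
  by (intro measurable_lebesgue_Pi) (simp add: measurable_ident_sets sets_PiM_N)

text \<open>The product measure is determined by its values on Borel boxes, and intersecting such a
  box with the given one acts on each side separately. Integrals of Borel functions over
  \<open>\<mu>\<close> thus become iterated integrals over the \<open>N i\<close>.\<close>

lemma distr_lebesgue_Pi: "distr \<mu> (Pi\<^sub>M {1..d} N) (\<lambda>x. x) = Pi\<^sub>M {1..d} N"
proof (rule PiM_eqI)
  fix A assume A: "\<And>i. i \<in> {1..d} \<Longrightarrow> A i \<in> sets (N i)"
  have "emeasure (distr \<mu> (Pi\<^sub>M {1..d} N) (\<lambda>x. x)) (Pi\<^sub>E {1..d} A) = emeasure \<mu> (Pi\<^sub>E {1..d} A \<inter> Pi\<^sub>E {1..d} \<Omega>)"
    using A by (subst emeasure_distr[OF measurable_id_\<mu>]) (auto simp: space_lebesgue_Pi intro!: sets_PiM_I_finite)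
  also have "Pi\<^sub>E {1..d} A \<inter> Pi\<^sub>E {1..d} \<Omega> = Pi\<^sub>E {1..d} (\<lambda>i. A i \<inter> \<Omega> i)"
    by (rule PiE_Int)
  also have "emeasure \<mu> \<dots> = (\<Prod>i\<in>{1..d}. emeasure lebesgue (A i \<inter> \<Omega> i))"
    using A \<Omega> by (intro emeasure_lebesgue_Pi_PiE) (auto intro: sets_completionI_sets)
  also have "\<dots> = (\<Prod>i\<in>{1..d}. emeasure (N i) (A i))"
    using A by (intro prod.cong) (auto simp: emeasure_N)
  finally show "emeasure (distr \<mu> (Pi\<^sub>M {1..d} N) (\<lambda>x. x)) (Pi\<^sub>E {1..d} A) = (\<Prod>i\<in>{1..d}. emeasure (N i) (A i))" .
qed auto

text \<open>For integration \<open>|f|\<close> can be replaced by the Borel function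
  \<open>F\<close>. The exceptional set is null for Lebesgue measure, and the product of the
  \<open>N i\<close> gives it the measure of its part in the box, again zero.\<close>

lemma borel_version:
  assumes f: "f \<in> borel_measurable \<mu>"
  obtains F Z where "F \<in> borel_measurable (Pi\<^sub>M {1..d} N)" "Z \<in> null_sets (Pi\<^sub>M {1..d} N)"
    "\<And>x. x \<in> Pi\<^sub>E {1..d} \<Omega> \<Longrightarrow> x \<notin> Z \<Longrightarrow> ennreal \<bar>f x\<bar> = F x"
proof -
  let ?P = "Pi\<^sub>M {1..d} (\<lambda>_. lborel :: real measure)" and ?O = "Pi\<^sub>E {1..d} \<Omega>"
  have O: "?O \<in> sets (completion ?P)" using \<Omega> by (intro sets_PiE_lebesgue_Pi)
  then have "?O \<inter> space (completion ?P) \<in> sets (completion ?P)"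
    by (metis sets.Int_space_eq2)
  moreover have "(\<lambda>x. ennreal \<bar>f x\<bar>) \<in> borel_measurable (restrict_space (completion ?P) ?O)"
    using f by (simp add: lebesgue_Pi_def)
  \<comment> \<open>Extension by zero turns measurability on the box into measurability for the
    completion on the whole space.\<close>
  ultimately have "(\<lambda>x. ennreal \<bar>f x\<bar> * indicator ?O x) \<in> borel_measurable (completion ?P)"
    by (simp only: borel_measurable_restrict_space_iff_ennreal)
  then obtain F where F: "F \<in> borel_measurable ?P"
      "AE x in ?P. ennreal \<bar>f x\<bar> * indicator ?O x = F x"
    using completion_ex_borel_measurable by blast
  from F(2) obtain Z where Z: "{x\<in>space ?P. ennreal \<bar>f x\<bar> * indicator ?O x \<noteq> F x} \<subseteq> Z"
      "Z \<in> null_sets ?P"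
    by (auto elim: AE_E simp: null_sets_def)
  have ZN: "Z \<in> sets (Pi\<^sub>M {1..d} N)" using Z by (auto simp: sets_PiM_N)
  have "emeasure (Pi\<^sub>M {1..d} N) Z = emeasure \<mu> (Z \<inter> ?O)"
    using ZN by (subst distr_lebesgue_Pi[symmetric], subst emeasure_distr[OF measurable_id_\<mu>])
      (auto simp: space_lebesgue_Pi)
  also have "\<dots> = emeasure (completion ?P) (Z \<inter> ?O)"
    unfolding lebesgue_Pi_def using O
    by (intro emeasure_restrict_space) (auto simp: sets.Int_space_eq2[OF O] sets.Int_space_eq1 Int_commute)
  also have "\<dots> \<le> emeasure (completion ?P) Z"
    using Z by (intro emeasure_mono) auto
  also have "\<dots> = 0" using Z(2) null_sets_completionI by blast
  finally have "Z \<in> null_sets (Pi\<^sub>M {1..d} N)" using ZN by auto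
  moreover have "F \<in> borel_measurable (Pi\<^sub>M {1..d} N)"
    using F(1) by (simp cong: measurable_cong_sets add: sets_PiM_N)
  moreover have "ennreal \<bar>f x\<bar> = F x" if "x \<in> ?O" "x \<notin> Z" for x
    using Z(1) that by (auto simp: space_PiM PiE_iff)
  ultimately show ?thesis using that by blast
qed

end

section \<open>Embedding into the unmixed space\<close>

text \<open>Tonelli for the indicator of a null set \<open>Z\<close> containing the exceptional
  points: almost every section of \<open>Z\<close> is null. This carries exceptional sets from one
  coordinate to the next.\<close>

lemma (in product_sigma_finite) AE_PiM_insert:
  assumes I: "finite I" "i \<notin> I" and Q: "AE x in Pi\<^sub>M (insert i I) M. Q x"
  shows "AE x in Pi\<^sub>M I M. AE t in M i. Q (x(i := t))"
proof -
  from Q obtain Z where Z: "{x \<in> space (Pi\<^sub>M (insert i I) M). \<not> Q x} \<subseteq> Z"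
      "emeasure (Pi\<^sub>M (insert i I) M) Z = 0" and [measurable]: "Z \<in> sets (Pi\<^sub>M (insert i I) M)"
    by (rule AE_E)
  have [measurable]: "(\<lambda>(x, t). x(i := t)) \<in> measurable (Pi\<^sub>M I M \<Otimes>\<^sub>M M i) (Pi\<^sub>M (insert i I) M)"
    by (rule measurable_add_dim)
  have m: "(\<lambda>(x, t). indicator Z (x(i := t))) \<in> borel_measurable (Pi\<^sub>M I M \<Otimes>\<^sub>M M i)"
    by measurable
  have "(\<integral>\<^sup>+x. \<integral>\<^sup>+t. indicator Z (x(i := t)) \<partial>M i \<partial>Pi\<^sub>M I M) = 0"
    using product_nn_integral_insert[OF I, of "indicator Z"] Z(2) by simp
  then have "AE x in Pi\<^sub>M I M. (\<integral>\<^sup>+t. indicator Z (x(i := t)) \<partial>M i) = 0"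
    using m by (subst (asm) nn_integral_0_iff_AE) (auto intro!: sigma_finite_measure.borel_measurable_nn_integral[OF sigma_finite_measures])
  then show ?thesis
    using AE_space
  proof eventually_elim
    case (elim x)
    have "(\<lambda>t. indicator Z (x(i := t)) :: ennreal) \<in> borel_measurable (M i)"
      using measurable_compose[OF measurable_Pair1'[OF elim(2)] m] by simp
    with elim(1) have "AE t in M i. indicator Z (x(i := t)) = (0 :: ennreal)"
      by (simp add: nn_integral_0_iff_AE)
    then show ?case
      using AE_space
    proof eventually_elim
      case (elim t)
      then have "x(i := t) \<in> space (Pi\<^sub>M (insert i I) M)"
        using \<open>x \<in> space (Pi\<^sub>M I M)\<close> by (auto simp: space_PiM PiE_iff extensional_def)
      with elim(1) Z(1) show ?case by (auto simp: indicator_eq_0_iff)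
    qed
  qed
qed

text \<open>Follows the recursion of \<open>mixed_norm_upto\<close>, so that the two can be compared
  one coordinate at a time.\<close>

primrec iter_nn_integral ::
  "(nat \<Rightarrow> 'a measure) \<Rightarrow> nat \<Rightarrow> ((nat \<Rightarrow> 'a) \<Rightarrow> ennreal) \<Rightarrow> (nat \<Rightarrow> 'a) \<Rightarrow> ennreal" where
  "iter_nn_integral M 0 F = F"
| "iter_nn_integral M (Suc k) F =
     (\<lambda>x. \<integral>\<^sup>+t. iter_nn_integral M k F (x(Suc k := t)) \<partial>M (Suc k))"

lemma insert_Suc_atLeastAtMost: "Suc k \<le> d \<Longrightarrow> insert (Suc k) {Suc (Suc k)..d} = {Suc k..d}"
  by auto

context lebesgue_box begin

lemma measurable_iter_nn_integral:
  assumes "F \<in> borel_measurable (Pi\<^sub>M {1..d} N)" "k \<le> d"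
  shows "iter_nn_integral N k F \<in> borel_measurable (Pi\<^sub>M {Suc k..d} N)"
  using assms(2)
proof (induction k)
  case 0
  then show ?case using assms(1) by (simp add: One_nat_def)
next
  case (Suc k)
  have "(\<lambda>(x, t). x(Suc k := t)) \<in> measurable (Pi\<^sub>M {Suc (Suc k)..d} N \<Otimes>\<^sub>M N (Suc k)) (Pi\<^sub>M {Suc k..d} N)"
    using measurable_add_dim[of "Suc k" "{Suc (Suc k)..d}" N] Suc.prems by (simp add: insert_Suc_atLeastAtMost)
  from measurable_compose[OF this, of "iter_nn_integral N k F" borel] Suc have "(\<lambda>(x, t). iter_nn_integral N k F (x(Suc k := t)))
      \<in> borel_measurable (Pi\<^sub>M {Suc (Suc k)..d} N \<Otimes>\<^sub>M N (Suc k))"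
    by (simp add: split_beta')
  then show ?case by (auto intro: sigma_finite_measure.borel_measurable_nn_integral[OF sigma_finite_measures])
qed

text \<open>Tonelli, splitting coordinate \<open>Suc k\<close> off the remaining product at each
  step; for \<open>k = d\<close> the outer integral is over a single point.\<close>

lemma nn_integral_eq_iter:
  assumes "F \<in> borel_measurable (Pi\<^sub>M {1..d} N)" "k \<le> d"
  shows "(\<integral>\<^sup>+x. F x \<partial>Pi\<^sub>M {1..d} N) = (\<integral>\<^sup>+x. iter_nn_integral N k F x \<partial>Pi\<^sub>M {Suc k..d} N)"
  using assms(2)
proof (induction k)
  case 0
  then show ?case by (simp add: One_nat_def)
next
  case (Suc k)
  then have "(\<integral>\<^sup>+x. F x \<partial>Pi\<^sub>M {1..d} N)
      = (\<integral>\<^sup>+x. iter_nn_integral N k F x \<partial>Pi\<^sub>M (insert (Suc k) {Suc (Suc k)..d}) N)"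
    by (simp add: insert_Suc_atLeastAtMost)
  also have "\<dots> = (\<integral>\<^sup>+x. iter_nn_integral N (Suc k) F x \<partial>Pi\<^sub>M {Suc (Suc k)..d} N)"
    using Suc.prems measurable_iter_nn_integral[OF assms(1), of k]
    by (subst product_nn_integral_insert) (auto simp: insert_Suc_atLeastAtMost)
  finally show ?case .
qed

text \<open>The embedding into \<open>L_q\<close>, with both sides raised to the power
  \<open>q\<close>. Each coordinate costs the factor \<open>a i\<close> of the one-dimensional
  estimate; these factors depend on \<open>\<Omega>\<close> only, hence \<open>C\<close> serves all
  \<open>f\<close>.\<close>

lemma nn_integral_powr_le_mixed_norm:
  fixes q :: real
  assumes q: "0 < q" "\<And>i. i \<in> {1..d} \<Longrightarrow> ennreal q \<le> p i"
  shows "\<exists>C::real. 0 < C \<and> (\<forall>f\<in>borel_measurable \<mu>.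
    (\<integral>\<^sup>+x. ennpowr (ennreal \<bar>f x\<bar>) q \<partial>\<mu>) \<le> ennreal C * ennpowr (mixed_norm d \<Omega> p f) q)"
proof -
  define a where "a i = measure (lebesgue_on (\<Omega> i)) (space (lebesgue_on (\<Omega> i))) + 1" for i
  define C where "C k = (\<Prod>i\<in>{1..k}. a i)" for k
  have a: "0 < a i" for i
    using measure_nonneg[of "lebesgue_on (\<Omega> i)" "space (lebesgue_on (\<Omega> i))"] unfolding a_def by linarith
  have C: "0 < C k" for k unfolding C_def using a by (intro prod_pos) auto
  have C_Suc: "C (Suc k) = C k * a (Suc k)" for k by (simp add: C_def)
  have "(\<integral>\<^sup>+x. ennpowr (ennreal \<bar>f x\<bar>) q \<partial>\<mu>) \<le> ennreal (C d) * ennpowr (mixed_norm d \<Omega> p f) q"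
    if f: "f \<in> borel_measurable \<mu>" for f
  proof -
    obtain F Z where F[measurable]: "F \<in> borel_measurable (Pi\<^sub>M {1..d} N)"
      and Z: "Z \<in> null_sets (Pi\<^sub>M {1..d} N)"
      and FZ: "\<And>x. x \<in> Pi\<^sub>E {1..d} \<Omega> \<Longrightarrow> x \<notin> Z \<Longrightarrow> ennreal \<bar>f x\<bar> = F x"
      using borel_version[OF f] by blast
    define G where "G x = ennpowr (F x) q" for x
    have G: "G \<in> borel_measurable (Pi\<^sub>M {1..d} N)" unfolding G_def by measurable
    let ?M = "\<lambda>k. mixed_norm_upto \<Omega> p k (\<lambda>x. ennreal \<bar>f x\<bar>)"
    \<comment> \<open>The integral is iterated over the Borel function \<open>G\<close>, the norm
      over \<open>f\<close> itself. The two are related only inside the box and off a null set, so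
      each stage holds for almost all outer variables.\<close>
    have key: "AE y in Pi\<^sub>M {Suc k..d} N. y \<in> Pi\<^sub>E {Suc k..d} \<Omega> \<longrightarrow>
        iter_nn_integral N k G y \<le> ennreal (C k) * ennpowr (?M k y) q" if "k \<le> d" for k
      using that
    proof (induction k)
      case 0
      have "AE y in Pi\<^sub>M {1..d} N. y \<notin> Z" by (rule AE_not_in[OF Z])
      then have "AE y in Pi\<^sub>M {1..d} N. y \<in> Pi\<^sub>E {1..d} \<Omega> \<longrightarrow> ennreal \<bar>f y\<bar> = F y"
        using FZ by (auto elim: eventually_mono)
      then show ?case
        unfolding One_nat_def[symmetric] by eventually_elim (simp add: G_def C_def)
    next
      case (Suc k)
      then have k: "Suc k \<in> {1..d}" by auto
      have "AE y in Pi\<^sub>M {Suc (Suc k)..d} N. AE t in N (Suc k).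
          y(Suc k := t) \<in> Pi\<^sub>E {Suc k..d} \<Omega> \<longrightarrow>
          iter_nn_integral N k G (y(Suc k := t)) \<le> ennreal (C k) * ennpowr (?M k (y(Suc k := t))) q"
      proof (rule AE_PiM_insert)
        show "AE y in Pi\<^sub>M (insert (Suc k) {Suc (Suc k)..d}) N. y \<in> Pi\<^sub>E {Suc k..d} \<Omega> \<longrightarrow>
            iter_nn_integral N k G y \<le> ennreal (C k) * ennpowr (?M k y) q"
          unfolding insert_Suc_atLeastAtMost[OF Suc.prems] using Suc by simp
      qed auto
      then show ?case
        using AE_space
      proof eventually_elim
        case (elim y)
        show ?case
        proof
          assume y: "y \<in> Pi\<^sub>E {Suc (Suc k)..d} \<Omega>"
          let ?L = "lebesgue_on (\<Omega> (Suc k))"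
          have m: "(\<lambda>t. iter_nn_integral N k G (y(Suc k := t))) \<in> borel_measurable borel"
          proof -
            have "(\<lambda>t. y(Suc k := t)) \<in> measurable (N (Suc k)) (Pi\<^sub>M {Suc k..d} N)"
              using measurable_compose[OF measurable_Pair1'[OF elim(2)]
                measurable_add_dim[of "Suc k" "{Suc (Suc k)..d}" N]] Suc.prems
              by (simp add: insert_Suc_atLeastAtMost)
            from measurable_compose[OF this measurable_iter_nn_integral[OF G]] Suc.prems
            show ?thesis by (simp cong: measurable_cong_sets)
          qed
          have "AE t in ?L. iter_nn_integral N k G (y(Suc k := t)) \<le> ennreal (C k) * ennpowr (?M k (y(Suc k := t))) q"
            using AE_N[OF k elim(1)] AE_space
          proof eventually_elim
            case (elim t)
            then have "y(Suc k := t) \<in> Pi\<^sub>E {Suc k..d} \<Omega>"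
              using PiE_fun_upd[OF _ y, of t "Suc k"] Suc.prems
              by (simp add: space_restrict_space insert_Suc_atLeastAtMost)
            with elim show ?case by blast
          qed
          then have "(\<integral>\<^sup>+t. iter_nn_integral N k G (y(Suc k := t)) \<partial>?L)
              \<le> ennreal (C k * (measure ?L (space ?L) + 1)) * ennpowr (Lq_norm (p (Suc k)) ?L (\<lambda>t. ?M k (y(Suc k := t)))) q"
            using q(1) q(2)[OF k] C
            by (intro nn_integral_le_Lq_norm finite_measure_lebesgue_on[OF k] measurable_lebesgue_on_borel[OF m])
          then show "iter_nn_integral N (Suc k) G y \<le> ennreal (C (Suc k)) * ennpowr (?M (Suc k) y) q"
            using nn_integral_N[OF k m] by (simp add: C_Suc a_def)
        qed
      qed
    qed
    have "iter_nn_integral N d G (\<lambda>_. undefined) \<le> ennreal (C d) * ennpowr (mixed_norm d \<Omega> p f) q"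
    proof -
      \<comment> \<open>With all coordinates integrated out, the product measure is counting measure
        on the single point \<open>\<lambda>_. undefined\<close>, so an almost-everywhere statement
        holds at that point, where \<open>mixed_norm\<close> is evaluated.\<close>
      have empty: "{Suc d..d} = {}" by simp
      show ?thesis
        using key[OF order_refl] unfolding empty PiM_empty AE_count_space PiE_empty_domain
        by (simp only: mixed_norm_def) blast
    qed
    moreover have "(\<integral>\<^sup>+x. G x \<partial>Pi\<^sub>M {1..d} N) = iter_nn_integral N d G (\<lambda>_. undefined)"
      using nn_integral_eq_iter[OF G, of d] by (simp add: nn_integral_empty)
    moreover have "(\<integral>\<^sup>+x. ennpowr (ennreal \<bar>f x\<bar>) q \<partial>\<mu>) = (\<integral>\<^sup>+x. G x \<partial>Pi\<^sub>M {1..d} N)"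
    proof -
      have "AE x in distr \<mu> (Pi\<^sub>M {1..d} N) (\<lambda>x. x). x \<notin> Z"
        using AE_not_in[OF Z] by (simp only: distr_lebesgue_Pi)
      then have Z\<mu>: "AE x in \<mu>. x \<notin> Z"
        using AE_distrD[OF measurable_id_\<mu>] by blast
      have "AE x in \<mu>. ennpowr (ennreal \<bar>f x\<bar>) q = G x"
        using Z\<mu> AE_space by eventually_elim (simp add: G_def FZ space_lebesgue_Pi)
      then have "(\<integral>\<^sup>+x. ennpowr (ennreal \<bar>f x\<bar>) q \<partial>\<mu>) = (\<integral>\<^sup>+x. G x \<partial>\<mu>)"
        by (rule nn_integral_cong_AE)
      also have "\<dots> = (\<integral>\<^sup>+x. G x \<partial>distr \<mu> (Pi\<^sub>M {1..d} N) (\<lambda>x. x))"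
        using measurable_id_\<mu> G by (simp add: nn_integral_distr)
      finally show ?thesis by (simp only: distr_lebesgue_Pi)
    qed
    ultimately show ?thesis by simp
  qed
  with C show ?thesis by blast
qed

end

section \<open>Rearrangements and sufficiency\<close>

text \<open>Each \<open>h x\<close> is the length of
  \<open>{s. 0 < s \<and> ennreal s < h x}\<close>; Tonelli exchanges the two integrals.\<close>

lemma nn_integral_layer_cake:
  assumes "sigma_finite_measure M" and [measurable]: "h \<in> borel_measurable M"
  shows "(\<integral>\<^sup>+x. h x \<partial>M) = (\<integral>\<^sup>+s\<in>{0<..}. emeasure M {x \<in> space M. ennreal s < h x} \<partial>lborel)"
proof -
  interpret sigma_finite_measure M by fact
  interpret pair_sigma_finite lborel M ..
  let ?f = "\<lambda>s x. indicator {0<..} s * indicator {x \<in> space M. ennreal s < h x} x :: ennreal"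
  have "h x = (\<integral>\<^sup>+s. ?f s x \<partial>lborel)" if "x \<in> space M" for x
  proof (cases "h x")
    case (real r)
    have "(\<integral>\<^sup>+s. ?f s x \<partial>lborel) = (\<integral>\<^sup>+s. indicator {0<..<r} s \<partial>lborel)"
      using real that by (intro nn_integral_cong) (auto simp: indicator_def ennreal_less_iff)
    then show ?thesis using real by simp
  next
    case top
    have eq: "(\<integral>\<^sup>+s. ?f s x \<partial>lborel) = (\<integral>\<^sup>+s. indicator {0<..} (s::real) \<partial>lborel)"
      using top that by (intro nn_integral_cong) (auto simp: indicator_def)
    have inf: "(SUP n. of_nat n) \<le> emeasure lborel {0 :: real<..}"
    proof (rule SUP_least)
      fix n
      have "of_nat n = emeasure lborel {0<..<real n}"
        by (simp add: ennreal_of_nat_eq_real_of_nat)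
      also have "\<dots> \<le> emeasure lborel {0 :: real<..}"
        by (intro emeasure_mono) auto
      finally show "of_nat n \<le> emeasure lborel {0 :: real<..}" .
    qed
    have "(\<integral>\<^sup>+s. indicator {0<..} (s::real) \<partial>lborel) = top"
      using inf unfolding ennreal_SUP_of_nat_eq_top top_unique by simp
    then show ?thesis using top eq by (simp only:)
  qed
  then have "(\<integral>\<^sup>+x. h x \<partial>M) = (\<integral>\<^sup>+x. \<integral>\<^sup>+s. ?f s x \<partial>lborel \<partial>M)"
    by (rule nn_integral_cong)
  also have "\<dots> = (\<integral>\<^sup>+s. \<integral>\<^sup>+x. ?f s x \<partial>M \<partial>lborel)"
    by (rule Fubini') measurable
  also have "\<dots> = (\<integral>\<^sup>+s\<in>{0<..}. emeasure M {x \<in> space M. ennreal s < h x} \<partial>lborel)"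
    by (intro nn_integral_cong) (simp add: nn_integral_cmult mult.commute)
  finally show ?thesis .
qed

section \<open>The decreasing rearrangement\<close>

lemma borel_measurable_antimono_ennreal:
  fixes g :: "real \<Rightarrow> ennreal"
  assumes "antimono g"
  shows "g \<in> borel_measurable borel"
proof (rule borel_measurableI_greater)
  fix y
  have "is_interval {t. y < g t}"
    using antimonoD[OF assms] by (auto simp: is_interval_1 intro: less_le_trans)
  then show "{t \<in> space borel. y < g t} \<in> sets borel"
    by (simp add: real_interval_borel_measurable)
qed

lemma ennreal_less_ennpowr_iff:
  assumes "0 < q" "0 < s"
  shows "ennreal s < ennpowr y q \<longleftrightarrow> ennreal (s powr (1 / q)) < y"
proof -
  have "ennreal s = ennpowr (ennreal (s powr (1 / q))) q"
    using assms by (simp add: ennpowr_ennreal powr_powr)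
  then show ?thesis using assms by (simp add: ennpowr_less_iff)
qed

lemma antimono_rearrangement: "antimono (rearrangement M f)"
  by (intro antimonoI) (auto simp: rearrangement_def intro!: Inf_superset_mono image_mono
      intro: order_trans ennreal_leI)

lemma measurable_rearrangement [measurable]: "rearrangement M f \<in> borel_measurable borel"
  by (rule borel_measurable_antimono_ennreal[OF antimono_rearrangement])

text \<open>Otherwise \<open>s\<close> would be an admissible level in the infimum.\<close>

lemma less_rearrangementD:
  assumes "ennreal s < rearrangement M f t" "0 < s"
  shows "ennreal t < emeasure M {x \<in> space M. s < \<bar>f x\<bar>}"
proof (rule ccontr)
  assume "\<not> ?thesis"
  then have "rearrangement M f t \<le> ennreal s"
    unfolding rearrangement_def using assms(2) by (intro Inf_lower) (auto simp: not_less)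
  with assms(1) show False by simp
qed

text \<open>Layer cake on both sides: for every \<open>s > 0\<close> the points \<open>t > 0\<close>
  with \<open>f*(t)^q > s\<close> lie below the measure of the set where \<open>|f|^q > s\<close>,
  so they form a set of at most that length.\<close>

lemma nn_integral_rearrangement_le:
  assumes "sigma_finite_measure M" and [measurable]: "f \<in> borel_measurable M" and q: "0 < q"
  shows "(\<integral>\<^sup>+t\<in>{0<..}. ennpowr (rearrangement M f t) q \<partial>lborel) \<le> (\<integral>\<^sup>+x. ennpowr (ennreal \<bar>f x\<bar>) q \<partial>M)"
proof -
  let ?h = "\<lambda>t. ennpowr (rearrangement M f t) q * indicator {0<..} t"
  have "(\<integral>\<^sup>+t. ?h t \<partial>lborel)
      = (\<integral>\<^sup>+s\<in>{0<..}. emeasure lborel {t \<in> space lborel. ennreal s < ?h t} \<partial>lborel)"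
    by (rule nn_integral_layer_cake) (auto intro: sigma_finite_lborel)
  also have "\<dots> \<le> (\<integral>\<^sup>+s\<in>{0<..}. emeasure M {x \<in> space M. ennreal s < ennpowr (ennreal \<bar>f x\<bar>) q} \<partial>lborel)"
  proof (intro nn_integral_mono)
    fix s :: real
    let ?m = "emeasure M {x \<in> space M. ennreal s < ennpowr (ennreal \<bar>f x\<bar>) q}"
    have "emeasure lborel {t \<in> space lborel. ennreal s < ?h t} \<le> ?m" if s: "0 < s"
    proof (cases ?m)
      case (real m)
      have "{t \<in> space lborel. ennreal s < ?h t} \<subseteq> {0<..<m}"
      proof
        fix t assume "t \<in> {t \<in> space lborel. ennreal s < ?h t}"
        then have t: "0 < t" "ennreal s < ennpowr (rearrangement M f t) q"
          by (cases "0 < t"; simp)+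
        then have "ennreal (s powr (1 / q)) < rearrangement M f t"
          using q s by (simp add: ennreal_less_ennpowr_iff)
        then have "ennreal t < emeasure M {x \<in> space M. s powr (1 / q) < \<bar>f x\<bar>}"
          using s by (intro less_rearrangementD) auto
        also have "\<dots> = ?m"
          using q s by (simp add: ennreal_less_ennpowr_iff ennreal_less_iff)
        finally show "t \<in> {0<..<m}" using t real by (simp add: ennreal_less_iff)
      qed
      then have "emeasure lborel {t \<in> space lborel. ennreal s < ?h t} \<le> emeasure lborel {0<..<m}"
        by (intro emeasure_mono) auto
      then show ?thesis using real by simp
    qed simp
    then show "emeasure lborel {t \<in> space lborel. ennreal s < ?h t} * indicator {0<..} s \<le> ?m * indicator {0<..} s"
      by (auto simp: indicator_def)
  qed
  also have "\<dots> = (\<integral>\<^sup>+x. ennpowr (ennreal \<bar>f x\<bar>) q \<partial>M)"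
    using assms(1) by (intro nn_integral_layer_cake[symmetric]) auto
  finally show ?thesis .
qed

text \<open>Since the rearrangement decreases, its value at \<open>t\<close> bounds it from below on
  \<open>(0, t)\<close>.\<close>

lemma mult_rearrangement_powr_le:
  assumes "sigma_finite_measure M" "f \<in> borel_measurable M" "0 < q" "0 < t"
  shows "ennreal t * ennpowr (rearrangement M f t) q \<le> (\<integral>\<^sup>+x. ennpowr (ennreal \<bar>f x\<bar>) q \<partial>M)"
proof -
  have "ennreal t * ennpowr (rearrangement M f t) q
      = (\<integral>\<^sup>+\<tau>. ennpowr (rearrangement M f t) q * indicator {0<..<t} \<tau> \<partial>lborel)"
    using assms(4) by (subst nn_integral_cmult_indicator) (auto simp: mult.commute)
  also have "\<dots> \<le> (\<integral>\<^sup>+\<tau>\<in>{0<..}. ennpowr (rearrangement M f \<tau>) q \<partial>lborel)"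
    using assms(3) by (intro nn_integral_mono)
      (auto simp: indicator_def intro!: ennpowr_mono antimonoD[OF antimono_rearrangement])
  also have "\<dots> \<le> (\<integral>\<^sup>+x. ennpowr (ennreal \<bar>f x\<bar>) q \<partial>M)"
    using assms by (intro nn_integral_rearrangement_le)
  finally show ?thesis .
qed

text \<open>The constant \<open>K\<close> is the same for all \<open>v\<close>. With
  \<open>c\<close> the integral of \<open>|f|^q\<close> and \<open>v = w\<close> finite, the
  integral on the left is at most \<open>K^w c^(w/q)\<close>, whose \<open>w\<close>-th root no
  longer contains \<open>w\<close>.\<close>

lemma weighted_rearr_norm_le:
  fixes q K :: real
  assumes M: "sigma_finite_measure M" and f: "f \<in> borel_measurable M" and q: "0 < q" "ennreal q \<le> v"
    and K: "0 < K" "\<And>t. t \<in> {0<..<\<epsilon>} \<Longrightarrow> 0 \<le> \<kappa> t \<and> \<kappa> t \<le> K"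
  shows "weighted_rearr_norm \<epsilon> \<kappa> q v (rearrangement M f)
    \<le> ennreal K * ennpowr (\<integral>\<^sup>+x. ennpowr (ennreal \<bar>f x\<bar>) q \<partial>M) (1 / q)"
proof (cases "\<integral>\<^sup>+x. ennpowr (ennreal \<bar>f x\<bar>) q \<partial>M")
  case top
  then show ?thesis using K by (simp add: ennreal_mult_top)
next
  case (real c)
  let ?g = "rearrangement M f"
  \<comment> \<open>Finiteness of \<open>c\<close> makes the rearrangement finite at every
    \<open>t > 0\<close>, so the estimates below are inequalities between reals.\<close>
  have g: "\<exists>r\<ge>0. ?g t = ennreal r \<and> t * r powr q \<le> c" if "0 < t" for t
  proof -
    have le: "ennreal t * ennpowr (?g t) q \<le> ennreal c"
      using mult_rearrangement_powr_le[OF M f q(1) that] real by simp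
    show ?thesis
    proof (cases "?g t")
      case (real r)
      with le that \<open>0 \<le> c\<close> show ?thesis
        by (auto simp: ennpowr_ennreal simp flip: ennreal_mult)
    next
      case top
      with le that show ?thesis by (simp add: ennreal_mult_top top_unique)
    qed
  qed
  have root: "\<kappa> t * t powr (1 / q) * r \<le> K * (t * r powr q) powr (1 / q)"
    if t: "t \<in> {0<..<\<epsilon>}" and r: "0 \<le> r" for t r
  proof -
    have "(t * r powr q) powr (1 / q) = t powr (1 / q) * r"
      using t r q by (simp add: powr_mult powr_powr)
    then show ?thesis using K(2)[OF t] r by (simp add: mult.assoc mult_right_mono)
  qed
  have "weighted_rearr_norm \<epsilon> \<kappa> q v ?g \<le> ennreal (K * c powr (1 / q))"
  proof (cases v)
    case top
    show ?thesis unfolding weighted_rearr_norm_def top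
    proof (simp, rule SUP_least)
      fix t assume t: "t \<in> {0<..<\<epsilon>}"
      then obtain r where r: "0 \<le> r" "?g t = ennreal r" "t * r powr q \<le> c" using g[of t] by auto
      have "\<kappa> t * t powr (1 / q) * r \<le> K * (t * r powr q) powr (1 / q)" by (rule root[OF t r(1)])
      also have "\<dots> \<le> K * c powr (1 / q)"
        using r t K q by (intro mult_left_mono powr_mono2) auto
      finally show "ennreal (\<kappa> t * t powr (1 / q)) * ?g t \<le> ennreal (K * c powr (1 / q))"
        using r K(2)[OF t] by (simp add: ennreal_leI flip: ennreal_mult)
    qed
  next
    case (real w)
    with q have w: "0 < w" "q \<le> w" by auto
    \<comment> \<open>With \<open>B = t * r powr q \<le> c\<close>, the power
      \<open>B powr (w / q)\<close> splits into \<open>B powr (w / q - 1)\<close>, at most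
      \<open>c powr (w / q - 1)\<close> because \<open>q \<le> w\<close>, and one factor
      \<open>B\<close>, whose \<open>t\<close> cancels \<open>1 / t\<close>.\<close>
    let ?D = "K powr w * c powr (w / q - 1)"
    have pt: "ennpowr (ennreal (\<kappa> t * t powr (1 / q)) * ?g t) w * ennreal (1 / t) \<le> ennreal ?D * ennpowr (?g t) q"
      if t: "t \<in> {0<..<\<epsilon>}" for t
    proof -
      obtain r where r: "0 \<le> r" "?g t = ennreal r" "t * r powr q \<le> c" using g[of t] t by auto
      have "(\<kappa> t * t powr (1 / q) * r) powr w * (1 / t) \<le> ?D * r powr q"
      proof (cases "r = 0")
        case False
        define B where "B = t * r powr q"
        have B: "0 < B" "B \<le> c" using False t r by (auto simp: B_def)
        have "(\<kappa> t * t powr (1 / q) * r) powr w \<le> (K * B powr (1 / q)) powr w"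
          using root[OF t r(1)] w K(2)[OF t] r unfolding B_def by (intro powr_mono2) auto
        also have "\<dots> = K powr w * (B powr (w / q - 1) * B)"
        proof -
          have "B powr (w / q) = B powr (w / q - 1) * B"
            using B by (simp add: powr_diff)
          then show ?thesis using K(1) B by (simp add: powr_mult powr_powr)
        qed
        also have "\<dots> \<le> K powr w * (c powr (w / q - 1) * B)"
          using B w q by (intro mult_left_mono mult_right_mono powr_mono2) auto
        finally show ?thesis using t by (simp add: B_def field_simps)
      qed simp
      then show ?thesis
        using r K(2)[OF t] t
        by (simp add: ennpowr_ennreal ennreal_leI flip: ennreal_mult)
    qed
    have "(\<integral>\<^sup>+t\<in>{0<..<\<epsilon>}. (ennpowr (ennreal (\<kappa> t * t powr (1 / q)) * ?g t) w * ennreal (1 / t)) \<partial>lborel)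
        \<le> (\<integral>\<^sup>+t. ennreal ?D * (ennpowr (?g t) q * indicator {0<..} t) \<partial>lborel)"
      using pt by (intro nn_integral_mono) (auto simp: indicator_def)
    also have "\<dots> = ennreal ?D * (\<integral>\<^sup>+t\<in>{0<..}. ennpowr (?g t) q \<partial>lborel)"
      by (rule nn_integral_cmult) measurable
    also have "\<dots> \<le> ennreal ?D * ennreal c"
      using nn_integral_rearrangement_le[OF M f q(1)] \<open>_ = ennreal c\<close> by (intro mult_left_mono) auto
    also have "\<dots> = ennreal ((K * c powr (1 / q)) powr w)"
    proof -
      have "c powr (w / q - 1) * c = c powr (w / q)"
        using \<open>0 \<le> c\<close> by (cases "c = 0") (auto simp: powr_diff)
      then show ?thesis
        using K(1) \<open>0 \<le> c\<close> by (simp add: powr_mult powr_powr mult.assoc flip: ennreal_mult)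
    qed
    finally have "ennpowr (\<integral>\<^sup>+t\<in>{0<..<\<epsilon>}. (ennpowr (ennreal (\<kappa> t * t powr (1 / q)) * ?g t) w * ennreal (1 / t)) \<partial>lborel) (1 / w)
       \<le> ennpowr (ennreal ((K * c powr (1 / q)) powr w)) (1 / w)"
      using w by (intro ennpowr_mono) auto
    also have "\<dots> = ennreal (K * c powr (1 / q))"
      using w K(1) by (simp add: ennpowr_ennreal powr_powr)
    finally show ?thesis using real by (simp add: weighted_rearr_norm_def)
  qed
  then show ?thesis using real K by (simp add: ennpowr_ennreal ennreal_mult)
qed

section \<open>Test functions\<close>

text \<open>A coordinate on which the function does not depend contributes only a factor. For
  \<open>p = \<infinity>\<close> this factor is \<open>1\<close>, as the space is not null.\<close>

lemma Lq_norm_const: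
  assumes "finite_measure M" "emeasure M (space M) \<noteq> 0" "0 < p"
  shows "\<exists>b::real. 0 \<le> b \<and> (\<forall>c. Lq_norm p M (\<lambda>_. c) = ennreal b * c)"
proof (cases p)
  case (real s)
  interpret finite_measure M by fact
  from real assms have s: "0 < s" by auto
  have "Lq_norm p M (\<lambda>_. c) = ennreal (measure M (space M) powr (1 / s)) * c" for c
    using s real by (simp add: Lq_norm_def ennpowr_mult ennpowr_ennpowr emeasure_eq_measure ennpowr_ennreal mult.commute)
  then show ?thesis by (intro exI[of _ "measure M (space M) powr (1 / s)"]) auto
next
  case top
  then show ?thesis using assms by (intro exI[of _ 1]) (auto simp: Lq_norm_def esssup_const)
qed

lemma Lq_norm_cmult:
  assumes [measurable]: "g \<in> borel_measurable M" and "0 < q"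
  shows "Lq_norm (ennreal q) M (\<lambda>x. c * g x) = c * Lq_norm (ennreal q) M g"
  using assms(2) by (simp add: Lq_norm_def ennpowr_mult nn_integral_cmult ennpowr_ennpowr)

text \<open>A level \<open>r < s\<close> is not admissible in the infimum, because its superlevel
  set contains the set where \<open>|f| \<ge> s\<close>.\<close>

lemma rearrangement_ge:
  assumes "ennreal t < emeasure M {x \<in> space M. s \<le> \<bar>f x\<bar>}" and [measurable]: "f \<in> borel_measurable M"
  shows "ennreal s \<le> rearrangement M f t"
  unfolding rearrangement_def
proof (rule Inf_greatest)
  fix y assume "y \<in> ennreal ` {s. 0 < s \<and> emeasure M {x \<in> space M. s < \<bar>f x\<bar>} \<le> ennreal t}"
  then obtain r where r: "y = ennreal r" "emeasure M {x \<in> space M. r < \<bar>f x\<bar>} \<le> ennreal t" by auto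
  have "s \<le> r"
  proof (rule ccontr)
    assume "\<not> s \<le> r"
    then have "emeasure M {x \<in> space M. s \<le> \<bar>f x\<bar>} \<le> emeasure M {x \<in> space M. r < \<bar>f x\<bar>}"
      by (intro emeasure_mono) auto
    with r(2) assms(1) show False by simp
  qed
  then show "ennreal s \<le> y" using r by (simp add: ennreal_leI)
qed

section \<open>Functions of a single coordinate\<close>

context lebesgue_box begin

text \<open>Single points are null, so the distribution function of \<open>N j\<close> is
  continuous; its limits are \<open>0\<close> and the measure of \<open>\<Omega> j\<close>, and the
  intermediate value theorem applies.\<close>

lemma ex_initial_segment_measure:
  assumes j: "j \<in> {1..d}" and a: "0 < a" "a < measure lebesgue (\<Omega> j)"
  shows "\<exists>y. emeasure (N j) {..y} = ennreal a"
proof -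
  interpret finite_measure "N j" by (rule finite_measure_N[OF j])
  interpret finite_borel_measure "N j" by standard simp
  have m: "measure (N j) (space (N j)) = measure lebesgue (\<Omega> j)"
    using emeasure_N[OF j, of UNIV] by (simp add: measure_def)
  have cont: "isCont (cdf (N j)) x" for x
  proof -
    have "emeasure (N j) {x} \<le> emeasure lebesgue {x}"
      using emeasure_N[OF j, of "{x}"] by (auto intro: emeasure_mono simp del: emeasure_completion)
    then show ?thesis by (simp add: isCont_cdf measure_def)
  qed
  have "\<forall>\<^sub>F x in at_bot. cdf (N j) x < a"
    using cdf_lim_at_bot a(1) by (rule order_tendstoD)
  then obtain l where l: "cdf (N j) l < a" by (auto simp: eventually_at_bot_linorder)
  have "\<forall>\<^sub>F x in at_top. a < cdf (N j) x"
    using cdf_lim_at_top a(2) m by (intro order_tendstoD) auto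
  then obtain u where u: "a < cdf (N j) u" by (auto simp: eventually_at_top_linorder)
  have "l \<le> u" using l u cdf_nondecreasing[of u l] by linarith
  then obtain y where "cdf (N j) y = a"
    using IVT'[of "cdf (N j)" l a u] l u cont by (auto intro: continuous_at_imp_continuous_on)
  then show ?thesis by (auto simp: cdf_def emeasure_eq_measure)
qed

text \<open>Norms in the coordinates before and after \<open>j\<close> act on constants, and the one
  in coordinate \<open>j\<close> is homogeneous. The factor \<open>A\<close> does not depend on
  \<open>g\<close>, so one constant covers all test functions.\<close>

lemma mixed_norm_upto_coordinate:
  fixes q :: real
  assumes j: "j \<in> {1..d}" and p: "\<And>i. i \<in> {1..d} \<Longrightarrow> 0 < p i" and q: "p j = ennreal q" "0 < q"
    and pos: "\<And>i. i \<in> {1..d} \<Longrightarrow> 0 < emeasure lebesgue (\<Omega> i)" and k: "k \<le> d"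
  shows "\<exists>A::real. 0 \<le> A \<and> (\<forall>g\<in>borel_measurable borel. \<forall>x. mixed_norm_upto \<Omega> p k (\<lambda>x. g (x j)) x
    = ennreal A * (if k < j then g (x j) else Lq_norm (p j) (lebesgue_on (\<Omega> j)) g))"
  using k
proof (induction k)
  case 0
  then show ?case using j by (intro exI[of _ 1]) auto
next
  case (Suc k)
  then obtain A where A: "0 \<le> A" "\<And>g x. g \<in> borel_measurable borel \<Longrightarrow> mixed_norm_upto \<Omega> p k (\<lambda>x. g (x j)) x
    = ennreal A * (if k < j then g (x j) else Lq_norm (p j) (lebesgue_on (\<Omega> j)) g)" by auto
  have k: "Suc k \<in> {1..d}" using Suc.prems by auto
  let ?L = "lebesgue_on (\<Omega> (Suc k))"
  have "emeasure ?L (space ?L) \<noteq> 0"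
    using \<Omega>[OF k] pos[OF k] by (simp add: emeasure_restrict_space space_restrict_space del: emeasure_completion)
  from Lq_norm_const[OF finite_measure_lebesgue_on[OF k] this p[OF k]]
  obtain b where b: "0 \<le> b" "\<And>c. Lq_norm (p (Suc k)) ?L (\<lambda>_. c) = ennreal b * c" by blast
  show ?case
  proof (cases "Suc k = j")
    case True
    then show ?thesis using A q
      by (intro exI[of _ A]) (auto simp: Lq_norm_cmult measurable_lebesgue_on_borel)
  next
    case False
    then show ?thesis using A b
      by (intro exI[of _ "b * A"]) (auto simp: ennreal_mult mult.assoc)
  qed
qed

text \<open>\<open>A\<close> is chosen before \<open>b\<close> and \<open>n\<close>, since the
  necessity proof varies both with the constant fixed.\<close>

lemma test_functions:
  fixes q :: real
  assumes j: "j \<in> {1..d}" and p: "\<And>i. i \<in> {1..d} \<Longrightarrow> 0 < p i" and q: "p j = ennreal q" "0 < q"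
    and pos: "\<And>i. i \<in> {1..d} \<Longrightarrow> 0 < emeasure lebesgue (\<Omega> i)"
  shows "\<exists>A::real. 0 \<le> A \<and> (\<forall>b n. 0 < b \<and> ennreal b < emeasure \<mu> (Pi\<^sub>E {1..d} \<Omega>) \<longrightarrow>
    (\<exists>f\<in>mixed_Lebesgue d \<Omega> p. mixed_norm d \<Omega> p f = ennreal (A * (real (Suc n) * b) powr (1 / q)) \<and>
      (\<forall>k\<le>n. \<forall>t. t < b / 2 ^ k \<longrightarrow> ennreal (2 powr (k / q)) \<le> rearrangement \<mu> f t)))"
proof -
  obtain A where A: "0 \<le> A" "\<And>g x. g \<in> borel_measurable borel \<Longrightarrow> mixed_norm_upto \<Omega> p d (\<lambda>x. g (x j)) x
    = ennreal A * Lq_norm (p j) (lebesgue_on (\<Omega> j)) g"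
    using mixed_norm_upto_coordinate[of j p q d] j p q pos by auto
  have fin: "emeasure lebesgue (\<Omega> i) = ennreal (measure lebesgue (\<Omega> i))" if "i \<in> {1..d}" for i
    using finite_\<Omega>[OF that] by (intro emeasure_eq_ennreal_measure) auto
  have posm: "0 < measure lebesgue (\<Omega> i)" if "i \<in> {1..d}" for i
    using pos[OF that] fin[OF that] by (metis ennreal_0 less_irrefl zero_less_measure_iff measure_nonneg order_le_less)
  define m where "m = (\<Prod>i\<in>{1..d} - {j}. measure lebesgue (\<Omega> i))"
  have m: "0 < m" unfolding m_def using posm by (intro prod_pos) auto
  have box: "emeasure \<mu> (Pi\<^sub>E {1..d} (fun_upd \<Omega> j (\<Omega> j \<inter> S))) = ennreal m * emeasure (N j) S"
    if "S \<in> sets borel" for S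
  proof -
    have "emeasure \<mu> (Pi\<^sub>E {1..d} (fun_upd \<Omega> j (\<Omega> j \<inter> S)))
        = (\<Prod>i\<in>{1..d}. emeasure lebesgue ((fun_upd \<Omega> j (\<Omega> j \<inter> S)) i))"
      using \<Omega> j that by (intro emeasure_lebesgue_Pi_PiE) (auto intro: sets_completionI_sets)
    also have "\<dots> = emeasure lebesgue (\<Omega> j \<inter> S) * (\<Prod>i\<in>{1..d} - {j}. emeasure lebesgue (\<Omega> i))"
      using j by (subst prod.remove[of _ j]) (auto intro!: arg_cong2[where f="(*)"] prod.cong)
    also have "(\<Prod>i\<in>{1..d} - {j}. emeasure lebesgue (\<Omega> i)) = ennreal m"
      unfolding m_def using fin by (subst prod_ennreal[symmetric]) (auto intro!: prod.cong)
    finally show ?thesis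
      unfolding emeasure_N[OF j that] by (simp only: mult.commute Int_commute)
  qed
  have whole: "emeasure \<mu> (Pi\<^sub>E {1..d} \<Omega>) = ennreal (m * measure lebesgue (\<Omega> j))"
    using box[of UNIV] emeasure_N[OF j, of UNIV] fin[OF j] m by (simp add: ennreal_mult fun_upd_idem)
  have family: "\<exists>f\<in>mixed_Lebesgue d \<Omega> p.
      mixed_norm d \<Omega> p f = ennreal (A * (real (Suc n) * (b / m)) powr (1 / q)) \<and>
      (\<forall>k\<le>n. \<forall>t. t < b / 2 ^ k \<longrightarrow> ennreal (2 powr (k / q)) \<le> rearrangement \<mu> f t)"
    if b: "0 < b" "ennreal b < emeasure \<mu> (Pi\<^sub>E {1..d} \<Omega>)" for b n
  proof -
    \<comment> \<open>The sides of the box other than \<open>j\<close> have volume \<open>m\<close>,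
      so a segment of measure \<open>a / 2 ^ k\<close> in coordinate \<open>j\<close> yields a slice
      of volume \<open>b / 2 ^ k\<close>.\<close>
    define a where "a = b / m"
    have a: "0 < a" "a < measure lebesgue (\<Omega> j)"
      using b m by (auto simp: a_def whole ennreal_less_iff field_simps)
    have "\<exists>y. emeasure (N j) {..y} = ennreal (a / 2 ^ k)" for k :: nat
    proof (rule ex_initial_segment_measure[OF j])
      have "a / 2 ^ k \<le> a" using a by (simp add: field_simps)
      then show "a / 2 ^ k < measure lebesgue (\<Omega> j)" using a by linarith
    qed (use a in simp)
    then obtain y where y: "\<And>k::nat. emeasure (N j) {..y k} = ennreal (a / 2 ^ k)" by metis
    \<comment> \<open>\<open>G\<close> is the \<open>q\<close>-th power of the test function. The
      norm in coordinate \<open>j\<close> reduces to the integral of \<open>G\<close>, to which each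
      \<open>k\<close> contributes \<open>2 ^ k * (a / 2 ^ k) = a\<close>.\<close>
    define G where "G x = (\<Sum>k\<le>n. 2 ^ k * indicator {..y k} x :: real)" for x
    have G0: "0 \<le> G x" for x unfolding G_def by (intro sum_nonneg) auto
    have [measurable]: "G \<in> borel_measurable borel" unfolding G_def by measurable
    define f where "f x = G (x j) powr (1 / q)" for x :: "nat \<Rightarrow> real"
    have "(\<integral>\<^sup>+x. ennreal (G x) \<partial>lebesgue_on (\<Omega> j)) = (\<integral>\<^sup>+x. ennreal (G x) \<partial>N j)"
      by (rule nn_integral_N[symmetric, OF j]) measurable
    also have "\<dots> = (\<integral>\<^sup>+x. (\<Sum>k\<le>n. ennreal (2 ^ k) * indicator {..y k} x) \<partial>N j)"
      unfolding G_def by (intro nn_integral_cong, subst sum_ennreal[symmetric])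
        (auto simp: ennreal_mult ennreal_indicator)
    also have "\<dots> = (\<Sum>k\<le>n. \<integral>\<^sup>+x. ennreal (2 ^ k) * indicator {..y k} x \<partial>N j)"
      by (rule nn_integral_sum) measurable
    also have "\<dots> = (\<Sum>k\<le>n. ennreal (2 ^ k) * ennreal (a / 2 ^ k))"
      by (intro sum.cong refl, subst nn_integral_cmult_indicator) (auto simp: y)
    also have "\<dots> = (\<Sum>k\<le>n. ennreal a)"
      using a by (intro sum.cong) (auto simp flip: ennreal_mult)
    also have "\<dots> = ennreal (real (Suc n) * a)"
      using a by (simp add: ennreal_mult ennreal_of_nat_eq_real_of_nat)
    finally have int: "(\<integral>\<^sup>+x. ennreal (G x) \<partial>lebesgue_on (\<Omega> j)) = ennreal (real (Suc n) * a)" .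
    have "mixed_norm d \<Omega> p f = ennreal A * Lq_norm (p j) (lebesgue_on (\<Omega> j)) (\<lambda>x. ennreal \<bar>G x powr (1 / q)\<bar>)"
      unfolding mixed_norm_def f_def by (rule A(2)) measurable
    also have "\<dots> = ennreal A * ennpowr (\<integral>\<^sup>+x. ennreal (G x) \<partial>lebesgue_on (\<Omega> j)) (1 / q)"
      using q G0 by (simp add: Lq_norm_def ennpowr_ennreal powr_powr)
    also have "\<dots> = ennreal (A * (real (Suc n) * a) powr (1 / q))"
      unfolding int using a A(1) by (subst ennpowr_ennreal) (auto simp: ennreal_mult)
    finally have norm: "mixed_norm d \<Omega> p f = ennreal (A * (real (Suc n) * a) powr (1 / q))" .
    have fm: "f \<in> borel_measurable \<mu>"
      unfolding f_def using j by (intro measurable_lebesgue_Pi) measurable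
    have "ennreal (2 powr (k / q)) \<le> rearrangement \<mu> f t" if k: "k \<le> n" and t: "t < b / 2 ^ k" for k t
    proof (rule rearrangement_ge[OF _ fm])
      have "b / 2 ^ k = m * (a / 2 ^ k)" using m by (simp add: a_def)
      then have "ennreal t < ennreal m * emeasure (N j) {..y k}"
        using t m a b by (simp add: y ennreal_lessI flip: ennreal_mult)
      also have "\<dots> = emeasure \<mu> (Pi\<^sub>E {1..d} (fun_upd \<Omega> j (\<Omega> j \<inter> {..y k})))"
        by (simp add: box)
      also have "\<dots> \<le> emeasure \<mu> {x \<in> space \<mu>. 2 powr (k / q) \<le> \<bar>f x\<bar>}"
      proof (rule emeasure_mono)
        show "Pi\<^sub>E {1..d} (fun_upd \<Omega> j (\<Omega> j \<inter> {..y k})) \<subseteq> {x \<in> space \<mu>. 2 powr (k / q) \<le> \<bar>f x\<bar>}"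
        proof
          fix x assume x: "x \<in> Pi\<^sub>E {1..d} (fun_upd \<Omega> j (\<Omega> j \<inter> {..y k}))"
          have "x \<in> space \<mu>" using x by (auto simp: space_lebesgue_Pi PiE_iff split: if_splits)
          moreover have "x j \<le> y k" using PiE_mem[OF x j] by simp
          \<comment> \<open>The \<open>k\<close>-th summand alone gives this, the others being
            nonnegative.\<close>
          then have "2 ^ k \<le> G (x j)"
            using k member_le_sum[of k "{..n}" "\<lambda>k. 2 ^ k * indicator {..y k} (x j) :: real"]
            by (simp add: G_def)
          then have "(2 ^ k) powr (1 / q) \<le> G (x j) powr (1 / q)"
            using q by (intro powr_mono2) auto
          then have "2 powr (k / q) \<le> f x"
            by (simp add: f_def powr_powr flip: powr_realpow)
          ultimately show "x \<in> {x \<in> space \<mu>. 2 powr (k / q) \<le> \<bar>f x\<bar>}" by auto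
        qed
      qed (use fm in measurable)
      finally show "ennreal t < emeasure \<mu> {x \<in> space \<mu>. 2 powr (k / q) \<le> \<bar>f x\<bar>}" .
    qed
    with norm fm show ?thesis
      by (intro bexI[of _ f]) (auto simp: mixed_Lebesgue_def a_def)
  qed
  \<comment> \<open>The power of \<open>1 / m\<close> goes into the constant, since \<open>m\<close>
    depends on \<open>\<Omega>\<close> and \<open>j\<close> only.\<close>
  have rescale: "A * (real (Suc n) * (b / m)) powr (1 / q) = A * (1 / m) powr (1 / q) * (real (Suc n) * b) powr (1 / q)"
    if "0 < b" for b n
  proof -
    have "real (Suc n) * (b / m) = (1 / m) * (real (Suc n) * b)" by simp
    then show ?thesis using m that by (simp only: powr_mult mult.assoc)
  qed
  show ?thesis
  proof (intro exI[of _ "A * (1 / m) powr (1 / q)"] conjI allI impI)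
    fix b n
    assume b: "0 < b \<and> ennreal b < emeasure \<mu> (Pi\<^sub>E {1..d} \<Omega>)"
    show "\<exists>f\<in>mixed_Lebesgue d \<Omega> p.
        mixed_norm d \<Omega> p f = ennreal (A * (1 / m) powr (1 / q) * (real (Suc n) * b) powr (1 / q)) \<and>
        (\<forall>k\<le>n. \<forall>t. t < b / 2 ^ k \<longrightarrow> ennreal (2 powr (k / q)) \<le> rearrangement \<mu> f t)"
      unfolding rescale[OF conjunct1[OF b], symmetric] using family b by blast
  qed (use A(1) in simp)
qed

end

section \<open>Necessity\<close>

text \<open>Disjointness leaves at most one nonzero summand at \<open>t\<close>. This serves to
  bound an integral from below by the contributions of disjoint intervals.\<close>

lemma sum_indicator_le:
  fixes c :: "'i \<Rightarrow> ennreal"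
  assumes "finite S" "disjoint_family_on I S" "\<And>k. k \<in> S \<Longrightarrow> t \<in> I k \<Longrightarrow> c k \<le> H"
  shows "(\<Sum>k\<in>S. c k * indicator (I k) t) \<le> H"
proof (cases "\<exists>k\<in>S. t \<in> I k")
  case True
  then obtain k where k: "k \<in> S" "t \<in> I k" by blast
  have "t \<notin> I l" if "l \<in> S - {k}" for l
    using assms(2) k that by (auto simp: disjoint_family_on_def)
  then have "(\<Sum>l\<in>S - {k}. c l * indicator (I l) t) = 0" by (intro sum.neutral) auto
  then show ?thesis using k assms by (simp add: sum.remove[OF assms(1) k(1)])
next
  case False
  then have "(\<Sum>k\<in>S. c k * indicator (I k) t) = 0" by (intro sum.neutral) auto
  then show ?thesis by simp
qed

text \<open>The case \<open>n = 0\<close>, \<open>b = 2 * t\<close> of the test functions: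
  \<open>t < b\<close> gives \<open>1 \<le> g t\<close>, so the supremum is tested at
  \<open>t\<close> itself and the powers of \<open>t\<close> cancel.\<close>

lemma weight_le_of_sup_bound:
  fixes q B t :: real
  assumes q: "0 < q" and t: "t \<in> {0<..<\<epsilon>}" and B: "0 \<le> B" and \<kappa>: "0 \<le> \<kappa> t"
    and g: "1 \<le> g t"
    and le: "weighted_rearr_norm \<epsilon> \<kappa> q \<infinity> g \<le> ennreal (B * (2 * t) powr (1 / q))"
  shows "\<kappa> t \<le> B * 2 powr (1 / q)"
proof -
  have "ennreal (\<kappa> t * t powr (1 / q)) * 1 \<le> ennreal (\<kappa> t * t powr (1 / q)) * g t"
    using g by (intro mult_left_mono) auto
  also have "\<dots> \<le> weighted_rearr_norm \<epsilon> \<kappa> q \<infinity> g"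
    unfolding weighted_rearr_norm_def using t by (auto intro: SUP_upper)
  also note le
  finally have "\<kappa> t * t powr (1 / q) \<le> B * (2 * t) powr (1 / q)"
    using B by simp
  also have "\<dots> = (B * 2 powr (1 / q)) * t powr (1 / q)"
    using t by (simp add: powr_mult)
  finally show ?thesis using t by simp
qed

text \<open>On the \<open>k\<close>-th dyadic interval the three factors are at least
  \<open>\<kappa> b\<close>, \<open>(b / 2 ^ Suc k) powr (1 / q)\<close> and
  \<open>2 powr (k / q)\<close>; the product \<open>D\<close> of these bounds is independent of
  \<open>k\<close>. The \<open>n + 1\<close> intervals thus have equal lower bounds, and comparison
  with the norm leaves \<open>b\<close> only in \<open>\<kappa> b\<close>.\<close>

lemma weight_le_of_integral_bound:
  fixes q w B b :: real
  assumes q: "0 < q" and w: "0 < w" and b: "b \<in> {0<..\<epsilon>}" and B: "0 \<le> B"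
    and \<kappa>: "\<And>t. t \<in> {0<..\<epsilon>} \<Longrightarrow> 0 < \<kappa> t" "antimono_on {0<..\<epsilon>} \<kappa>"
    and g: "\<And>k t. k \<le> n \<Longrightarrow> t < b / 2 ^ k \<Longrightarrow> ennreal (2 powr (k / q)) \<le> g t"
    and le: "weighted_rearr_norm \<epsilon> \<kappa> q (ennreal w) g \<le> ennreal (B * (real (Suc n) * b) powr (1 / q))"
  shows "(real (Suc n) / 2) powr (1 / w) * \<kappa> b \<le> B * 2 powr (1 / q) * real (Suc n) powr (1 / q)"
proof -
  define D where "D = \<kappa> b * (b / 2) powr (1 / q)"
  define I where "I k = {b / 2 ^ Suc k<..<b / 2 ^ k}" for k :: nat
  have b0: "0 < b" and \<kappa>b: "0 < \<kappa> b" using b \<kappa>(1)[of b] by auto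
  then have D: "0 < D" by (simp add: D_def)
  have disj: "disjoint_family_on I {..n}"
  proof -
    have "I k \<inter> I l = {}" if "k < l" for k l
    proof -
      have "(2::real) ^ Suc k \<le> 2 ^ l" using that by (intro power_increasing) auto
      then have "b / 2 ^ l \<le> b / 2 ^ Suc k" using b0 by (intro divide_left_mono) auto
      then show ?thesis by (auto simp: I_def)
    qed
    then show ?thesis
      unfolding disjoint_family_on_def by (metis Int_commute linorder_neqE_nat)
  qed
  let ?H = "\<lambda>t. ennpowr (ennreal (\<kappa> t * t powr (1 / q)) * g t) w * ennreal (1 / t)"
  have H: "ennreal (D powr w * (2 ^ k / b)) \<le> ?H t * indicator {0<..<\<epsilon>} t" if k: "k \<le> n" and t: "t \<in> I k" for k t
  proof -
    have t0: "b / 2 ^ Suc k < t" "t < b / 2 ^ k" using t by (auto simp: I_def)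
    have "b / 2 ^ k \<le> b" using b0 by (simp add: field_simps)
    moreover have "0 < b / 2 ^ Suc k" using b0 by simp
    ultimately have tb: "0 < t" "t < b" "t < \<epsilon>" using t0 b by (auto simp del: power_Suc)
    have "\<kappa> b \<le> \<kappa> t" using \<kappa>(2) b tb by (auto simp: monotone_on_def)
    moreover have "(b / 2 ^ Suc k) powr (1 / q) \<le> t powr (1 / q)"
      using t0 b0 q by (intro powr_mono2) auto
    ultimately have "\<kappa> b * (b / 2 ^ Suc k) powr (1 / q) * 2 powr (k / q) \<le> \<kappa> t * t powr (1 / q) * 2 powr (k / q)"
      using \<kappa>b by (intro mult_right_mono mult_mono) auto
    moreover have "(b / 2 ^ Suc k) powr (1 / q) * 2 powr (k / q) = (b / 2) powr (1 / q)"
    proof -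
      have "2 powr (k / q) = (2 ^ k) powr (1 / q)"
        by (simp add: powr_powr flip: powr_realpow)
      then have "(b / 2 ^ Suc k) powr (1 / q) * 2 powr (k / q) = (b / 2 ^ Suc k * 2 ^ k) powr (1 / q)"
        using b0 by (simp only: powr_mult)
      then show ?thesis by simp
    qed
    ultimately have "D \<le> \<kappa> t * t powr (1 / q) * 2 powr (k / q)"
      by (simp only: D_def mult.assoc)
    then have "ennreal D \<le> ennreal (\<kappa> t * t powr (1 / q)) * ennreal (2 powr (k / q))"
      using \<kappa>b \<open>\<kappa> b \<le> \<kappa> t\<close> by (simp add: ennreal_leI flip: ennreal_mult)
    also have "\<dots> \<le> ennreal (\<kappa> t * t powr (1 / q)) * g t"
      using g[OF k t0(2)] by (rule mult_left_mono) simp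
    finally have "ennpowr (ennreal D) w \<le> ennpowr (ennreal (\<kappa> t * t powr (1 / q)) * g t) w"
      using w by (intro ennpowr_mono) auto
    \<comment> \<open>On this interval \<open>t < b / 2 ^ k\<close>. The height
      \<open>2 ^ k / b\<close> times the length \<open>b / 2 ^ Suc k\<close> of the interval is
      \<open>1 / 2\<close>.\<close>
    moreover have "ennreal (2 ^ k / b) \<le> ennreal (1 / t)"
      using tb t0 b0 by (intro ennreal_leI) (simp add: field_simps)
    ultimately have "ennpowr (ennreal D) w * ennreal (2 ^ k / b) \<le> ?H t"
      by (intro mult_mono) auto
    moreover have "ennreal (D powr w * (2 ^ k / b)) = ennpowr (ennreal D) w * ennreal (2 ^ k / b)"
      using D b0 by (simp add: ennpowr_ennreal flip: ennreal_mult)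
    moreover have "indicator {0<..<\<epsilon>} t = (1 :: ennreal)" using tb by simp
    ultimately show ?thesis by (simp only: mult_1_right)
  qed
  have "ennreal (real (Suc n) * (D powr w / 2)) = (\<Sum>k\<le>n. ennreal (D powr w * (2 ^ k / b)) * emeasure lborel (I k))"
  proof -
    have "ennreal (D powr w * (2 ^ k / b)) * emeasure lborel (I k) = ennreal (D powr w / 2)" for k
    proof -
      have "b / 2 ^ Suc k \<le> b / 2 ^ k" using b0 by (intro divide_left_mono) auto
      then have "emeasure lborel (I k) = ennreal (b / 2 ^ k - b / 2 ^ Suc k)" by (simp add: I_def)
      also have "b / 2 ^ k - b / 2 ^ Suc k = b / (2 * 2 ^ k)" by (simp add: field_simps)
      finally show ?thesis using b0 by (simp flip: ennreal_mult)
    qed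
    then have "(\<Sum>k\<le>n. ennreal (D powr w * (2 ^ k / b)) * emeasure lborel (I k)) = of_nat (Suc n) * ennreal (D powr w / 2)"
      by (simp only: sum_constant card_atMost)
    also have "\<dots> = ennreal (real (Suc n) * (D powr w / 2))"
      by (subst ennreal_mult) (auto simp: ennreal_of_nat_eq_real_of_nat)
    finally show ?thesis by (rule sym)
  qed
  also have "\<dots> = (\<integral>\<^sup>+t. (\<Sum>k\<le>n. ennreal (D powr w * (2 ^ k / b)) * indicator (I k) t) \<partial>lborel)"
    by (subst nn_integral_sum) (auto simp: I_def nn_integral_cmult_indicator)
  also have "\<dots> \<le> (\<integral>\<^sup>+t\<in>{0<..<\<epsilon>}. ?H t \<partial>lborel)"
    using H disj by (intro nn_integral_mono sum_indicator_le) auto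
  finally have "ennpowr (ennreal (real (Suc n) * (D powr w / 2))) (1 / w) \<le> weighted_rearr_norm \<epsilon> \<kappa> q (ennreal w) g"
    using w by (simp add: weighted_rearr_norm_def ennpowr_mono del: of_nat_Suc)
  also note le
  finally have "(real (Suc n) * (D powr w / 2)) powr (1 / w) \<le> B * (real (Suc n) * b) powr (1 / q)"
    using B by (simp add: ennpowr_ennreal del: of_nat_Suc)
  moreover have "(real (Suc n) * (D powr w / 2)) powr (1 / w) = (real (Suc n) / 2) powr (1 / w) * D"
  proof -
    have "real (Suc n) * (D powr w / 2) = (real (Suc n) / 2) * D powr w" by simp
    then show ?thesis using D w by (simp only: powr_mult) (simp add: powr_powr)
  qed
  moreover have "D = \<kappa> b * (1 / 2) powr (1 / q) * b powr (1 / q)"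
  proof -
    have "(b / 2) powr (1 / q) = ((1 / 2) * b) powr (1 / q)" by simp
    then show ?thesis unfolding D_def by (simp only: powr_mult mult.assoc)
  qed
  moreover have "B * (real (Suc n) * b) powr (1 / q) = B * real (Suc n) powr (1 / q) * b powr (1 / q)"
    by (simp add: powr_mult)
  \<comment> \<open>The factor \<open>b powr (1 / q)\<close> is common to both sides and cancels, so
    the estimate is uniform in \<open>b\<close>.\<close>
  ultimately have "((real (Suc n) / 2) powr (1 / w) * \<kappa> b * (1 / 2) powr (1 / q)) * b powr (1 / q)
      \<le> (B * real (Suc n) powr (1 / q)) * b powr (1 / q)"
    by (simp only: mult.assoc)
  then have "(real (Suc n) / 2) powr (1 / w) * \<kappa> b * (1 / 2) powr (1 / q) \<le> B * real (Suc n) powr (1 / q)"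
    using b0 by (simp del: of_nat_Suc)
  then have "((real (Suc n) / 2) powr (1 / w) * \<kappa> b * (1 / 2) powr (1 / q)) * 2 powr (1 / q)
      \<le> (B * real (Suc n) powr (1 / q)) * 2 powr (1 / q)"
    by (intro mult_right_mono) auto
  moreover have "(1 / 2) powr (1 / q) * 2 powr (1 / q) = (1 :: real)"
    by (simp flip: powr_mult)
  ultimately have "(real (Suc n) / 2) powr (1 / w) * \<kappa> b \<le> (B * real (Suc n) powr (1 / q)) * 2 powr (1 / q)"
    by (simp only: mult.assoc mult_1_right)
  then show ?thesis by (simp only: mult_ac)
qed

text \<open>If \<open>w < q\<close>, division by the power \<open>1 / q\<close> makes
  \<open>real (Suc n) powr e\<close> bounded with \<open>e = 1 / w - 1 / q > 0\<close>, which fails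
  for large \<open>n\<close>.\<close>

lemma exponent_le_of_powr_bound:
  fixes q w a B :: real
  assumes "0 < q" "0 < w" "0 < a"
    and le: "\<And>n. (real (Suc n) / 2) powr (1 / w) * a \<le> B * real (Suc n) powr (1 / q)"
  shows "q \<le> w"
proof (rule ccontr)
  assume "\<not> q \<le> w"
  define e where "e = 1 / w - 1 / q"
  have e: "0 < e" using \<open>\<not> q \<le> w\<close> assms by (simp add: e_def field_simps)
  define Y where "Y = B / (a * (1 / 2) powr (1 / w))"
  \<comment> \<open>The absolute value covers \<open>Y\<close> of either sign; this \<open>n\<close>
    makes \<open>real (Suc n) powr e\<close> exceed it.\<close>
  obtain n where n: "\<bar>Y\<bar> powr (1 / e) < real n" using reals_Archimedean2 by blast
  let ?x = "real (Suc n)"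
  have "?x powr e \<le> Y"
  proof -
    have "(?x / 2) powr (1 / w) = ((1 / 2) * ?x) powr (1 / w)" by simp
    also have "\<dots> = (1 / 2) powr (1 / w) * (?x powr e * ?x powr (1 / q))"
      by (simp only: powr_mult) (simp add: e_def flip: powr_add del: of_nat_Suc)
    finally have "(a * (1 / 2) powr (1 / w) * ?x powr e) * ?x powr (1 / q) \<le> B * ?x powr (1 / q)"
      using le[of n] by (simp add: mult_ac del: of_nat_Suc)
    then have "a * (1 / 2) powr (1 / w) * ?x powr e \<le> B" by (simp del: of_nat_Suc)
    then show ?thesis using assms(3) by (simp add: Y_def field_simps)
  qed
  moreover have "\<bar>Y\<bar> < ?x powr e"
  proof -
    have "(\<bar>Y\<bar> powr (1 / e)) powr e < ?x powr e"
      using n e by (intro powr_less_mono2) auto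
    then show ?thesis using e by (simp add: powr_powr)
  qed
  ultimately show False by linarith
qed

text \<open>The norm \<open>nrm\<close> enters only through the embedding \<open>upper\<close> and
  the test functions \<open>lower\<close>. The bound \<open>\<epsilon> \<le> W / 2\<close> keeps
  \<open>b = 2 * t\<close> below \<open>W\<close> for all \<open>t < \<epsilon>\<close>.\<close>

lemma weighted_rearr_bound_iff:
  fixes q W A C :: real and M :: "'a measure" and \<epsilon> :: real
  assumes M: "sigma_finite_measure M" and F: "F \<subseteq> borel_measurable M" and q: "0 < q"
    and A: "0 \<le> A" and C: "0 < C" and \<epsilon>: "0 < \<epsilon>" "\<epsilon> \<le> W / 2"
    and upper: "\<And>f. f \<in> F \<Longrightarrow>
      (\<integral>\<^sup>+x. ennpowr (ennreal \<bar>f x\<bar>) q \<partial>M) \<le> ennreal C * ennpowr (nrm f) q"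
    and lower: "\<And>b n. 0 < b \<Longrightarrow> b < W \<Longrightarrow> \<exists>f\<in>F. nrm f = ennreal (A * (real (Suc n) * b) powr (1 / q)) \<and>
      (\<forall>k\<le>n. \<forall>t. t < b / 2 ^ k \<longrightarrow> ennreal (2 powr (k / q)) \<le> rearrangement M f t)"
  defines "holds \<kappa> v \<equiv> \<exists>c::real. 0 < c \<and> (\<forall>f\<in>F.
    weighted_rearr_norm \<epsilon> \<kappa> q v (rearrangement M f) \<le> ennreal c * nrm f)"
  shows "(\<forall>t\<in>{0<..\<epsilon>}. 0 \<le> \<kappa> t) \<Longrightarrow> holds \<kappa> \<infinity> \<longleftrightarrow> bounded (\<kappa> ` {0<..\<epsilon>})"
    and "(\<forall>t\<in>{0<..\<epsilon>}. 0 < \<kappa> t) \<Longrightarrow> antimono_on {0<..\<epsilon>} \<kappa> \<Longrightarrow> 0 < v \<Longrightarrow>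
      holds \<kappa> v \<longleftrightarrow> bounded (\<kappa> ` {0<..\<epsilon>}) \<and> ennreal q \<le> v"
proof -
  have suff: "holds \<kappa> v"
    if "\<forall>t\<in>{0<..\<epsilon>}. 0 \<le> \<kappa> t" and bdd: "bounded (\<kappa> ` {0<..\<epsilon>})" and "ennreal q \<le> v" for \<kappa> v
  proof -
    obtain K where K: "0 < K" "\<forall>x\<in>\<kappa> ` {0<..\<epsilon>}. norm x \<le> K"
      using bdd by (auto simp: bounded_pos)
    have "weighted_rearr_norm \<epsilon> \<kappa> q v (rearrangement M f) \<le> ennreal (K * C powr (1 / q)) * nrm f"
      if f: "f \<in> F" for f
    proof -
      have "weighted_rearr_norm \<epsilon> \<kappa> q v (rearrangement M f)
          \<le> ennreal K * ennpowr (\<integral>\<^sup>+x. ennpowr (ennreal \<bar>f x\<bar>) q \<partial>M) (1 / q)"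
        using f F K \<open>\<forall>t\<in>{0<..\<epsilon>}. 0 \<le> \<kappa> t\<close> \<open>ennreal q \<le> v\<close>
        by (intro weighted_rearr_norm_le M q) force+
      also have "\<dots> \<le> ennreal K * ennpowr (ennreal C * ennpowr (nrm f) q) (1 / q)"
        using upper[OF f] q by (intro mult_left_mono ennpowr_mono) auto
      also have "\<dots> = ennreal (K * C powr (1 / q)) * nrm f"
        using q C K by (simp add: ennpowr_mult ennpowr_ennpowr ennpowr_ennreal ennreal_mult mult.assoc)
      finally show ?thesis .
    qed
    then show ?thesis
      unfolding holds_def using K C by (intro exI[of _ "K * C powr (1 / q)"]) simp
  qed
  have test: "\<exists>f\<in>F. weighted_rearr_norm \<epsilon> \<kappa> q v (rearrangement M f)
        \<le> ennreal ((c * A) * (real (Suc n) * b) powr (1 / q)) \<and>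
      (\<forall>k\<le>n. \<forall>t. t < b / 2 ^ k \<longrightarrow> ennreal (2 powr (k / q)) \<le> rearrangement M f t)"
    if c: "0 < c" and bnd: "\<forall>f\<in>F. weighted_rearr_norm \<epsilon> \<kappa> q v (rearrangement M f) \<le> ennreal c * nrm f"
      and b: "0 < b" "b < W" for \<kappa> v c b n
  proof -
    obtain f where f: "f \<in> F" "nrm f = ennreal (A * (real (Suc n) * b) powr (1 / q))"
      "\<forall>k\<le>n. \<forall>t. t < b / 2 ^ k \<longrightarrow> ennreal (2 powr (k / q)) \<le> rearrangement M f t"
      using lower[OF b, of n] by blast
    have "ennreal c * nrm f = ennreal ((c * A) * (real (Suc n) * b) powr (1 / q))"
      using f(2) c A by (simp add: mult.assoc del: of_nat_Suc flip: ennreal_mult)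
    then show ?thesis using f bnd by metis
  qed
  show sup: "holds \<kappa> \<infinity> \<longleftrightarrow> bounded (\<kappa> ` {0<..\<epsilon>})" if nn: "\<forall>t\<in>{0<..\<epsilon>}. 0 \<le> \<kappa> t" for \<kappa>
  proof
    assume "holds \<kappa> \<infinity>"
    then obtain c where c: "0 < c"
      "\<forall>f\<in>F. weighted_rearr_norm \<epsilon> \<kappa> q \<infinity> (rearrangement M f) \<le> ennreal c * nrm f"
      unfolding holds_def by blast
    have "\<kappa> t \<le> c * A * 2 powr (1 / q)" if t: "t \<in> {0<..<\<epsilon>}" for t
    proof -
      have "0 < 2 * t" "2 * t < W" using t \<epsilon> by auto
      from test[OF c this, of 0] obtain f where
        "weighted_rearr_norm \<epsilon> \<kappa> q \<infinity> (rearrangement M f) \<le> ennreal ((c * A) * (2 * t) powr (1 / q))"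
        "ennreal (2 powr (real 0 / q)) \<le> rearrangement M f t"
        using t by fastforce
      then show ?thesis
        using t nn c A q by (intro weight_le_of_sup_bound[where g = "rearrangement M f"]) auto
    qed
    \<comment> \<open>The supremum runs over \<open>t < \<epsilon>\<close>, so the endpoint enters
      through its own value.\<close>
    then have "\<kappa> t \<le> max (c * A * 2 powr (1 / q)) (\<kappa> \<epsilon>)" if "t \<in> {0<..\<epsilon>}" for t
      using that by (cases "t = \<epsilon>") (auto simp: le_max_iff_disj)
    then show "bounded (\<kappa> ` {0<..\<epsilon>})"
      using nn by (intro boundedI[of _ "max (c * A * 2 powr (1 / q)) (\<kappa> \<epsilon>)"]) auto
  qed (use suff nn in auto)
  assume pos: "\<forall>t\<in>{0<..\<epsilon>}. 0 < \<kappa> t" and anti: "antimono_on {0<..\<epsilon>} \<kappa>" and v: "0 < v"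
  show "holds \<kappa> v \<longleftrightarrow> bounded (\<kappa> ` {0<..\<epsilon>}) \<and> ennreal q \<le> v"
  proof (cases v)
    case top
    then show ?thesis using sup[of \<kappa>] pos by (auto simp: less_imp_le)
  next
    case (real w)
    with v have w: "0 < w" by auto
    show ?thesis
    proof
      assume "holds \<kappa> v"
      then obtain c where c: "0 < c"
        "\<forall>f\<in>F. weighted_rearr_norm \<epsilon> \<kappa> q v (rearrangement M f) \<le> ennreal c * nrm f"
        unfolding holds_def by blast
      have key: "(real (Suc n) / 2) powr (1 / w) * \<kappa> b \<le> (c * A) * 2 powr (1 / q) * real (Suc n) powr (1 / q)"
        if b: "b \<in> {0<..\<epsilon>}" for b n
      proof -
        have "0 < b" "b < W" using b \<epsilon> by auto
        from test[OF c this, of n] obtain f where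
          "weighted_rearr_norm \<epsilon> \<kappa> q v (rearrangement M f) \<le> ennreal ((c * A) * (real (Suc n) * b) powr (1 / q))"
          "\<forall>k\<le>n. \<forall>t. t < b / 2 ^ k \<longrightarrow> ennreal (2 powr (k / q)) \<le> rearrangement M f t"
          by blast
        then show ?thesis
          using b pos anti c A q w unfolding real
          by (intro weight_le_of_integral_bound[where g = "rearrangement M f" and \<epsilon> = \<epsilon>]) auto
      qed
      \<comment> \<open>Here \<open>b = \<epsilon>\<close> is fixed and \<open>n\<close> varies. For
        boundedness \<open>n = 0\<close> is fixed and \<open>b\<close> varies, which leaves the
        factor \<open>(1 / 2) powr (1 / w)\<close>.\<close>
      have "q \<le> w"
        using q w pos \<epsilon> key[of \<epsilon>] by (intro exponent_le_of_powr_bound[of q w "\<kappa> \<epsilon>"]) auto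
      moreover have "bounded (\<kappa> ` {0<..\<epsilon>})"
      proof (intro boundedI[of _ "(c * A) * 2 powr (1 / q) / (1 / 2) powr (1 / w)"])
        fix x assume "x \<in> \<kappa> ` {0<..\<epsilon>}"
        then show "norm x \<le> (c * A) * 2 powr (1 / q) / (1 / 2) powr (1 / w)"
          using key[of _ 0] pos by (force simp: field_simps)
      qed
      ultimately show "bounded (\<kappa> ` {0<..\<epsilon>}) \<and> ennreal q \<le> v"
        using real by (simp add: ennreal_leI)
    next
      assume "bounded (\<kappa> ` {0<..\<epsilon>}) \<and> ennreal q \<le> v"
      then show "holds \<kappa> v" using suff[of \<kappa> v] pos by (auto simp: less_imp_le)
    qed
  qed
qed

section \<open>The equivalences for mixed Lebesgue spaces\<close>

theorem corollary7p1:
  fixes d :: nat and \<Omega> :: "nat \<Rightarrow> real set" and p :: "nat \<Rightarrow> ennreal" and p_min :: ennreal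
  assumes "1 \<le> d"
    and "\<And>i. i \<in> {1..d} \<Longrightarrow> \<Omega> i \<in> sets lebesgue"
    and "\<And>i. i \<in> {1..d} \<Longrightarrow> 0 < emeasure lebesgue (\<Omega> i)"
    and "emeasure (lebesgue_Pi d \<Omega>) (Pi\<^sub>E {1..d} \<Omega>) < \<infinity>"
    and "\<And>i. i \<in> {1..d} \<Longrightarrow> 0 < p i"
    and "p_min = Min (p ` {1..d})"
    and "p_min < \<infinity>"
  shows "\<exists>\<epsilon>\<^sub>0::real. 0 < \<epsilon>\<^sub>0 \<and> (\<forall>\<epsilon>. 0 < \<epsilon> \<and> \<epsilon> \<le> \<epsilon>\<^sub>0 \<longrightarrow>
    (\<forall>(\<kappa>::real \<Rightarrow> real) (v::ennreal).
       (\<forall>t\<in>{0<..\<epsilon>}. 0 < \<kappa> t) \<and> antimono_on {0<..\<epsilon>} \<kappa> \<and> 0 < v \<longrightarrow>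
       ((\<exists>c::real. 0 < c \<and> (\<forall>f\<in>mixed_Lebesgue d \<Omega> p.
            weighted_rearr_norm \<epsilon> \<kappa> (enn2real p_min) v (rearrangement (lebesgue_Pi d \<Omega>) f)
              \<le> ennreal c * mixed_norm d \<Omega> p f))
        \<longleftrightarrow> bounded (\<kappa> ` {0<..\<epsilon>}) \<and> p_min \<le> v)) \<and>
    (\<forall>\<kappa>::real \<Rightarrow> real.
       (\<forall>t\<in>{0<..\<epsilon>}. 0 \<le> \<kappa> t) \<longrightarrow>
       ((\<exists>c::real. 0 < c \<and> (\<forall>f\<in>mixed_Lebesgue d \<Omega> p.
            weighted_rearr_norm \<epsilon> \<kappa> (enn2real p_min) \<infinity> (rearrangement (lebesgue_Pi d \<Omega>) f)
              \<le> ennreal c * mixed_norm d \<Omega> p f))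
        \<longleftrightarrow> bounded (\<kappa> ` {0<..\<epsilon>}))))"
proof -
  have "p_min \<in> p ` {1..d}"
    unfolding assms(6) using assms(1) by (intro Min_in) auto
  then obtain j where j: "j \<in> {1..d}" "p_min = p j" by blast
  define q where "q = enn2real p_min"
  have pq: "p_min = ennreal q" "0 < q"
    using assms(5)[OF j(1)] assms(7) j(2) by (auto simp: q_def enn2real_positive_iff)
  have qle: "ennreal q \<le> p i" if "i \<in> {1..d}" for i
    using that unfolding pq(1)[symmetric] assms(6) by (intro Min_le) auto
  let ?\<mu> = "lebesgue_Pi d \<Omega>" and ?O = "Pi\<^sub>E {1..d} \<Omega>"
  have prod: "emeasure ?\<mu> ?O = (\<Prod>i\<in>{1..d}. emeasure lebesgue (\<Omega> i))"
    using assms(2) by (intro emeasure_lebesgue_Pi_PiE) auto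
  have nz: "emeasure lebesgue (\<Omega> i) \<noteq> 0" if "i \<in> {1..d}" for i
    using assms(3)[OF that] by (metis less_irrefl)
  \<comment> \<open>All sides have positive measure, so one infinite side would make the volume of
    the box infinite.\<close>
  have fin: "emeasure lebesgue (\<Omega> i) < \<infinity>" if i: "i \<in> {1..d}" for i
  proof (rule ccontr)
    assume "\<not> emeasure lebesgue (\<Omega> i) < \<infinity>"
    then have "emeasure lebesgue (\<Omega> i) = top" by (metis infinity_ennreal_def less_top)
    moreover have "(\<Prod>i\<in>{1..d} - {i}. emeasure lebesgue (\<Omega> i)) \<noteq> 0"
      using nz by (auto simp: prod_zero_iff simp del: emeasure_completion)
    ultimately have "emeasure ?\<mu> ?O = top"
      unfolding prod using i by (subst prod.remove[of _ i]) (auto simp: ennreal_top_mult simp del: emeasure_completion)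
    then show False using assms(4) by simp
  qed
  interpret lebesgue_box d \<Omega>
    using assms(2) fin by unfold_locales auto
  define W where "W = measure ?\<mu> ?O"
  have W: "emeasure ?\<mu> ?O = ennreal W"
    unfolding W_def using assms(4) by (intro emeasure_eq_ennreal_measure) auto
  have "emeasure ?\<mu> ?O \<noteq> 0"
    unfolding prod using nz by (auto simp: prod_zero_iff simp del: emeasure_completion)
  then have W0: "0 < W" unfolding W by (simp add: ennreal_eq_0_iff)
  have sf: "sigma_finite_measure ?\<mu>"
  proof -
    interpret finite_measure ?\<mu>
      using assms(4) by (intro finite_measureI) (simp add: space_lebesgue_Pi)
    show ?thesis ..
  qed
  obtain C where C: "0 < C" "\<And>f. f \<in> borel_measurable ?\<mu> \<Longrightarrow>
      (\<integral>\<^sup>+x. ennpowr (ennreal \<bar>f x\<bar>) q \<partial>?\<mu>) \<le> ennreal C * ennpowr (mixed_norm d \<Omega> p f) q"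
    using nn_integral_powr_le_mixed_norm[of q p] pq(2) qle by blast
  have "p j = ennreal q" using pq(1) j(2) by simp
  from test_functions[of j p q, OF j(1) assms(5) this pq(2) assms(3)]
  obtain A where A: "0 \<le> A" "\<And>b n. 0 < b \<Longrightarrow> b < W \<Longrightarrow>
    \<exists>f\<in>mixed_Lebesgue d \<Omega> p. mixed_norm d \<Omega> p f = ennreal (A * (real (Suc n) * b) powr (1 / q)) \<and>
      (\<forall>k\<le>n. \<forall>t. t < b / 2 ^ k \<longrightarrow> ennreal (2 powr (k / q)) \<le> rearrangement ?\<mu> f t)"
    unfolding W using W0 by (auto simp: ennreal_less_iff simp del: of_nat_Suc)
  have sub: "mixed_Lebesgue d \<Omega> p \<subseteq> borel_measurable ?\<mu>"
    by (auto simp: mixed_Lebesgue_def)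
  note iff = weighted_rearr_bound_iff[where nrm = "mixed_norm d \<Omega> p", OF sf sub pq(2) A(1) C(1) _ _ C(2)[OF subsetD[OF sub]] A(2)]
  \<comment> \<open>The threshold is half the volume of the box, hence independent of
    \<open>\<kappa>\<close> and \<open>v\<close>.\<close>
  show ?thesis
    unfolding q_def[symmetric] unfolding pq(1)
    by (intro exI[of _ "W / 2"] conjI allI impI; (elim conjE)?)
      (use W0 in \<open>simp\<close>, (rule iff(2); assumption), (rule iff(1); assumption))
qed

end
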